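(* Let $H(\gamma):=\gamma\log(1/\gamma)-(1-\gamma)\log(1-\gamma)$ be the base-$e$ Shannon entropy (with $H(0)=H(1)=0$), and let $$\psi_S^{\mathbb{R}_+}(\delta,\rho):=H(\delta)+\delta H(\rho)-(1-\rho\delta)\log 2 .$$ For $\delta\in[1/2,1)$ let $\rho_S(\delta;\mathbb{R}_+^N)\in[0,1]$ denote the zero crossing of $\rho\mapsto\psi_S^{\mathbb{R}_+}(\delta,\rho)$ on $[0,1]$. Let $\delta\in[1/2,1)$ and $\rho\in(0,1)$ with $\rho<\rho_S(\delta;\mathbb{R}_+^N)$, and consider a sequence of triples of integers $(k_n,n,N_n)$, indexed by $n$, with $k_n<n<N_n$, $k_n/n\to\rho$ and $n/N_n\to\delta$ as $n\to\infty$. Write $k=k_n$, $N=N_n$. For each $n$ let $A$ be a random $n\times N$ matrix whose nullspace is an orthant-symmetric and generic random subspace. Then $$\mathrm{Prob}\{f_k(A\mathbb{R}_+^N)=f_k(\mathbb{R}_+^N)\}\to 1\quad\text{as } n\to\infty .$$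
   Context: $\mathbb{R}_+^N=\{x\in\mathbb{R}^N: x_i\ge 0\ \forall i\}$. For a polyhedron $Q$, $f_k(Q)$ denotes the number of $k$-dimensional faces of $Q$; $AQ$ is the image of $Q$ under $A$. A random $(N-n)\times N$ matrix $B$ is orthant-symmetric if for each diagonal matrix $S$ with diagonal in $\{-1,1\}^N$ and every measurable set $\Omega$, $\mathrm{Prob}\{BS\in\Omega\}=\mathrm{Prob}\{B\in\Omega\}$. Let $V_B$ be the linear span of the rows of $B$. If $B$ is orthant-symmetric, $V_B$ is called an orthant-symmetric random subspace. If every subset of $N-n$ columns of $B$ is almost surely linearly independent, $V_B$ is called a generic random subspace. A random $n\times N$ matrix $A$ has an orthant-symmetric and generic nullspace if its nullspace $\mathcal{N}(A)$ equals $V_B$ for a random matrix $B$ having both properties. *)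

theory Defs
  imports "HOL-Probability.Probability" "HOL-Analysis.Finite_Function_Topology"
begin

text \<open>
  Since the dimensions vary along a sequence, they cannot be types. Vectors of all dimensions
  live in the single real vector space of finitely supported functions on the natural
  numbers, in which \<open>vecs d\<close> is the copy of \<open>\<real>\<^sup>d\<close>; in this way \<^const>\<open>span\<close>,
  \<^const>\<open>dependent\<close> and \<^const>\<open>face_of\<close> are those of the library.
  An \<open>m \<times> d\<close> matrix is an extensional function on the index pairs
  \<open>{..<m} \<times> {..<d}\<close>, so that the library's finite product of Borel spaces is the Borel
  space of matrices.
\<close>

type_synonym vect = "nat \<Rightarrow>\<^sub>0 real"
type_synonym matrix = "nat \<times> nat \<Rightarrow> real"

definition vecs :: "nat \<Rightarrow> vect set" where
  "vecs d = {x. Poly_Mapping.keys x \<subseteq> {..<d}}"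

definition orthant :: "nat \<Rightarrow> vect set" where
  "orthant d = {x \<in> vecs d. \<forall>i<d. Poly_Mapping.lookup x i \<ge> 0}"

definition mat_row :: "nat \<Rightarrow> matrix \<Rightarrow> nat \<Rightarrow> vect" where
  "mat_row d X i = (\<Sum>j<d. Poly_Mapping.single j (X (i, j)))"

definition mat_col :: "nat \<Rightarrow> matrix \<Rightarrow> nat \<Rightarrow> vect" where
  "mat_col m X j = (\<Sum>i<m. Poly_Mapping.single i (X (i, j)))"

definition mat_vec :: "nat \<Rightarrow> nat \<Rightarrow> matrix \<Rightarrow> vect \<Rightarrow> vect" where
  "mat_vec m d X x =
     (\<Sum>i<m. Poly_Mapping.single i (\<Sum>j<d. X (i, j) * Poly_Mapping.lookup x j))"

definition nullspace :: "nat \<Rightarrow> nat \<Rightarrow> matrix \<Rightarrow> vect set" where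
  "nullspace m d X = {x \<in> vecs d. mat_vec m d X x = 0}"

definition row_space :: "nat \<Rightarrow> nat \<Rightarrow> matrix \<Rightarrow> vect set" where
  "row_space m d X = span (mat_row d X ` {..<m})"


text \<open>
  The library's \<^const>\<open>aff_dim\<close> is restricted to Euclidean spaces; the following is its
  defining condition, for a dimension that is a natural number. The empty face has no such
  dimension.
\<close>

definition has_aff_dim :: "'a::real_vector set \<Rightarrow> nat \<Rightarrow> bool" where
  "has_aff_dim F k \<longleftrightarrow>
     (\<exists>B. affine hull B = affine hull F \<and> \<not> affine_dependent B \<and> card B = k + 1)"

lemma has_aff_dim_iff_aff_dim:
  fixes F :: "'a::euclidean_space set"
  shows "has_aff_dim F k \<longleftrightarrow> aff_dim F = int k"
proof
  assume "has_aff_dim F k"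
  then obtain B where "affine hull B = affine hull F \<and> \<not> affine_dependent B" "card B = k + 1"
    unfolding has_aff_dim_def by blast
  with aff_dim_unique[of B F] show "aff_dim F = int k" by simp
next
  assume "aff_dim F = int k"
  with aff_dim_basis_exists[of F] show "has_aff_dim F k"
    unfolding has_aff_dim_def by (metis of_nat_Suc of_nat_eq_iff Suc_eq_plus1 add.commute)
qed

definition num_faces :: "nat \<Rightarrow> 'a::real_vector set \<Rightarrow> nat" where
  "num_faces k Q = card {F. F face_of Q \<and> has_aff_dim F k}"


abbreviation matrix_space :: "nat \<Rightarrow> nat \<Rightarrow> matrix measure" where
  "matrix_space m d \<equiv> (\<Pi>\<^sub>M ij \<in> {..<m} \<times> {..<d}. borel)"

definition random_matrix :: "'w measure \<Rightarrow> nat \<Rightarrow> nat \<Rightarrow> ('w \<Rightarrow> matrix) \<Rightarrow> bool" where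
  "random_matrix M m d X \<longleftrightarrow> X \<in> M \<rightarrow>\<^sub>M matrix_space m d"

text \<open>
  The product \<open>X S\<close> with the diagonal matrix \<open>S = diag (s 0, \<dots>, s (d - 1))\<close>.
\<close>

definition mat_mult_diag :: "nat \<Rightarrow> nat \<Rightarrow> matrix \<Rightarrow> (nat \<Rightarrow> real) \<Rightarrow> matrix" where
  "mat_mult_diag m d X s = (\<lambda>(i, j) \<in> {..<m} \<times> {..<d}. X (i, j) * s j)"

definition orthant_symmetric :: "'w measure \<Rightarrow> nat \<Rightarrow> nat \<Rightarrow> ('w \<Rightarrow> matrix) \<Rightarrow> bool" where
  "orthant_symmetric M m d B \<longleftrightarrow>
     (\<forall>s \<in> {..<d} \<rightarrow> {-1, 1}. \<forall>\<Omega> \<in> sets (matrix_space m d).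
        \<P>(\<omega> in M. mat_mult_diag m d (B \<omega>) s \<in> \<Omega>) = \<P>(\<omega> in M. B \<omega> \<in> \<Omega>))"

text \<open>
  Injectivity is needed because linear independence is meant for the indexed family of
  columns: a repeated column counts as a dependence.
\<close>

definition generic_columns :: "'w measure \<Rightarrow> nat \<Rightarrow> nat \<Rightarrow> ('w \<Rightarrow> matrix) \<Rightarrow> bool" where
  "generic_columns M m d B \<longleftrightarrow>
     (\<forall>J \<subseteq> {..<d}. card J = m \<longrightarrow>
        (AE \<omega> in M. inj_on (mat_col m (B \<omega>)) J \<and> independent (mat_col m (B \<omega>) ` J)))"

text \<open>
  As usual for random objects, the equality of the random subspaces is almost sure.
\<close>

definition orthant_symmetric_generic_nullspace ::
    "'w measure \<Rightarrow> nat \<Rightarrow> nat \<Rightarrow> ('w \<Rightarrow> matrix) \<Rightarrow> bool" where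
  "orthant_symmetric_generic_nullspace M n d A \<longleftrightarrow>
     (\<exists>B. random_matrix M (d - n) d B \<and>
          orthant_symmetric M (d - n) d B \<and>
          generic_columns M (d - n) d B \<and>
          (AE \<omega> in M. nullspace n d (A \<omega>) = row_space (d - n) d (B \<omega>)))"


text \<open>
  The convention \<open>H(0) = H(1) = 0\<close> is automatic, since \<open>1 / 0 = 0\<close> and \<open>ln 0 = 0\<close>.
\<close>

definition shannon_H :: "real \<Rightarrow> real" where
  "shannon_H \<gamma> = \<gamma> * ln (1 / \<gamma>) - (1 - \<gamma>) * ln (1 - \<gamma>)"

lemma shannon_H_0_1: "shannon_H 0 = 0" "shannon_H 1 = 0"
  by (simp_all add: shannon_H_def)

definition psi_S :: "real \<Rightarrow> real \<Rightarrow> real" where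
  "psi_S \<delta> \<rho> = shannon_H \<delta> + \<delta> * shannon_H \<rho> - (1 - \<rho> * \<delta>) * ln 2"

text \<open>
  For \<open>1/2 \<le> \<delta> < 1\<close> the function \<open>psi_S \<delta>\<close> is strictly concave on \<open>[0,1]\<close>, nonpositive
  at \<open>0\<close> (zero exactly for \<open>\<delta> = 1/2\<close>) and positive at \<open>1\<close>, so that it has exactly one zero
  there.
\<close>

definition rho_S :: "real \<Rightarrow> real" where
  "rho_S \<delta> = (THE \<rho>. 0 \<le> \<rho> \<and> \<rho> \<le> 1 \<and> psi_S \<delta> \<rho> = 0)"

end

theory Submission
  imports Defs "HOL-Real_Asymp.Real_Asymp"
begin

text \<open>
  For \<open>k \<ge> 1\<close> all \<open>k\<close>-faces of the orthant survive under \<open>A\<close> iff, for every set \<open>J\<close> of \<open>k\<close>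
  coordinates, the nullspace of \<open>A\<close> contains no nonzero vector that is nonnegative off \<open>J\<close>. This is
  an open condition on \<open>A\<close>, hence the event is measurable. For fixed \<open>J\<close>, orthant symmetry and a
  count of the sign patterns that a subspace of dimension \<open>N - n\<close> attains on \<open>N - k\<close> coordinates
  (as in Wendel's theorem) bound the probability of failure by
  \<open>2\<^sup>-\<^sup>(\<^sup>N\<^sup>-\<^sup>k\<^sup>)\<close> times a partial sum of binomial coefficients. The union bound over the
  \<open>N choose k\<close> sets \<open>J\<close> costs the exponential rate \<open>psi_S \<delta> \<rho>\<close>, which is negative below \<open>rho_S \<delta>\<close>.
\<close>

text \<open>The matrix \<open>A\<close> is known only through its nullspace, so losing a face is
  expressed by kernel vectors of \<open>A\<close> and bounded by the corresponding event for row
  combinations of \<open>B\<close>, on which the symmetry acts. The symmetry is used by averaging: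
  all sign changes have the same probability of failure, while almost surely the number of failing
  ones obeys a deterministic bound. The bound is slightly weaker than Wendel's exact count, twice
  the sum of the binomials C(N-k-1, l) for l < N-n, but has the same exponential rate. Rates are
  obtained without Stirling's formula: both binomial quantities are bounded by powers of fixed
  numbers \<open>p\<close> and \<open>x\<close>, the limits of k/N and (N-n)/(n-k). The second bound
  requires x \<le> 1, that is \<rho> \<le> 2 - 1/\<delta>, which is why
  \<open>rho_S \<delta>\<close> is compared with this value.\<close>

section \<open>Faces of finitely generated cones\<close>

text \<open>Nonempty faces of cones contain 0, so their affine dimension becomes a linear one, for
  which bases and exchange are available.\<close>

lemma has_aff_dim_iff_independent:
  fixes F :: "'a::real_vector set"
  assumes "0 \<in> F"
  shows "has_aff_dim F k \<longleftrightarrow> (\<exists>b. independent b \<and> finite b \<and> card b = k \<and> span b = span F)"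
proof
  have F: "affine hull F = span F"
    by (rule affine_hull_span_0) (simp add: assms hull_inc)
  {
    assume "has_aff_dim F k"
    then obtain B where B: "affine hull B = span F" "\<not> affine_dependent B" "card B = k + 1"
      unfolding has_aff_dim_def F by blast
    then obtain a where a: "a \<in> B" by fastforce
    define D where "D = (\<lambda>x. - a + x) ` (B - {a})"
    have indep: "independent D"
      using B(2) a affine_dependent_iff_dependent2 unfolding D_def by blast
    have hull: "affine hull B = (\<lambda>x. a + x) ` span D"
      unfolding D_def by (rule affine_hull_span2[OF a])
    have "0 \<in> (\<lambda>x. a + x) ` span D"
      by (metis hull B(1) span_zero)
    then obtain d where "d \<in> span D" "a + d = 0" by auto
    then have "a = - d" by (simp add: eq_neg_iff_add_eq_0)
    then have "a \<in> span D" using \<open>d \<in> span D\<close> by (simp add: span_neg)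
    have "(\<lambda>x. a + x) ` span D = span D"
    proof (intro subset_antisym subsetI)
      fix x assume "x \<in> span D"
      then have "x - a \<in> span D" using \<open>a \<in> span D\<close> by (rule span_diff)
      then show "x \<in> (\<lambda>x. a + x) ` span D" by (metis add_diff_cancel_left' diff_add_cancel image_eqI add.commute)
    qed (use \<open>a \<in> span D\<close> in \<open>auto intro: span_add\<close>)
    moreover have "card D = k"
      unfolding D_def using B(3) a by (subst card_image) auto
    moreover have "finite D"
      unfolding D_def using B(3) by (metis card.infinite finite_Diff finite_imageI Suc_eq_plus1 nat.distinct(1))
    ultimately show "\<exists>b. independent b \<and> finite b \<and> card b = k \<and> span b = span F"
      using indep hull B(1) by auto
  }
  assume "\<exists>b. independent b \<and> finite b \<and> card b = k \<and> span b = span F"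
  then obtain b where b: "independent b" "finite b" "card b = k" "span b = span F" by blast
  have "0 \<notin> b" using b(1) dependent_zero by blast
  have "affine hull (insert 0 b) = span F"
    using affine_hull_span_0[of "insert 0 b"] b(4) by (simp add: hull_inc span_insert_0)
  moreover have "\<not> affine_dependent (insert 0 b)"
    using affine_dependent_imp_dependent2 b(1) by blast
  moreover have "card (insert 0 b) = k + 1"
    using b \<open>0 \<notin> b\<close> by simp
  ultimately show "has_aff_dim F k"
    unfolding has_aff_dim_def F by blast
qed

section \<open>Faces of general convex cones\<close>

lemma face_of_convex_cone:
  fixes F :: "'a::real_vector set"
  assumes "convex_cone C" "F face_of C" "F \<noteq> {}"
  shows "convex_cone F"
  using assms face_of_conic face_of_imp_convex unfolding convex_cone_def by blast

text \<open>\<open>x + y\<close> is the midpoint of \<open>2 *\<^sub>R x\<close> and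
  \<open>2 *\<^sub>R y\<close>, so the face property applies to that segment. For
  \<open>x = y\<close> the open segment is empty and scaling replaces it.\<close>

lemma face_of_convex_cone_summand:
  fixes F :: "'a::real_vector set"
  assumes C: "convex_cone C" and F: "F face_of C" and xy: "x \<in> C" "y \<in> C" "x + y \<in> F"
  shows "x \<in> F"
proof (cases "x = y")
  case True
  have "convex_cone F" using face_of_convex_cone[OF C F] xy by blast
  then have "(1/2) *\<^sub>R (x + y) \<in> F" using xy(3) convex_cone_scaleR by (metis zero_le_divide_1_iff zero_le_numeral)
  then show ?thesis using True by (simp flip: scaleR_2)
next
  case False
  have cF: "convex_cone F" using face_of_convex_cone[OF C F] xy by blast
  have "x + y \<in> open_segment (2 *\<^sub>R x) (2 *\<^sub>R y)"
    unfolding in_segment using False by (auto intro!: exI[of _ "1/2"])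
  moreover have "2 *\<^sub>R x \<in> C" "2 *\<^sub>R y \<in> C" using convex_cone_scaleR[OF C] xy by auto
  ultimately have "2 *\<^sub>R x \<in> F" using face_ofD[OF F] xy(3) by blast
  then have "(1/2) *\<^sub>R 2 *\<^sub>R x \<in> F" using convex_cone_scaleR[OF cF, of "1/2"] by fastforce
  then show ?thesis by simp
qed

text \<open>Differences form a subspace because a negative scalar merely swaps the two
  terms.\<close>

lemma span_convex_cone:
  assumes "convex_cone S"
  shows "span S = {x - y | x y. x \<in> S \<and> y \<in> S}"
proof
  have "subspace {x - y | x y. x \<in> S \<and> y \<in> S}"
  proof (rule subspaceI)
    show "0 \<in> {x - y |x y. x \<in> S \<and> y \<in> S}"
      using convex_cone_contains_0[OF assms] by force
  next
    fix a b assume "a \<in> {x - y |x y. x \<in> S \<and> y \<in> S}" "b \<in> {x - y |x y. x \<in> S \<and> y \<in> S}"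
    then obtain x y x' y' where "a = x - y" "b = x' - y'" "x \<in> S" "y \<in> S" "x' \<in> S" "y' \<in> S"
      by blast
    moreover from this have "a + b = (x + x') - (y + y')" by simp
    ultimately show "a + b \<in> {x - y |x y. x \<in> S \<and> y \<in> S}"
      using convex_cone_add[OF assms] by blast
  next
    fix c a assume "a \<in> {x - y |x y. x \<in> S \<and> y \<in> S}"
    then obtain x y where a: "a = x - y" "x \<in> S" "y \<in> S" by blast
    show "c *\<^sub>R a \<in> {x - y |x y. x \<in> S \<and> y \<in> S}"
    proof (cases "c \<ge> 0")
      case True
      then show ?thesis
        using convex_cone_scaleR[OF assms True] a by (force simp: scaleR_diff_right)
    next
      case False
      then have "- c \<ge> 0" by simp
      then have "(- c) *\<^sub>R x \<in> S" "(- c) *\<^sub>R y \<in> S"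
        using convex_cone_scaleR[OF assms] a by blast+
      moreover have "c *\<^sub>R a = (- c) *\<^sub>R y - (- c) *\<^sub>R x" by (simp add: a scaleR_diff_right)
      ultimately show ?thesis by blast
    qed
  qed
  moreover have "S \<subseteq> {x - y | x y. x \<in> S \<and> y \<in> S}"
    using convex_cone_contains_0[OF assms] by force
  ultimately show "span S \<subseteq> {x - y | x y. x \<in> S \<and> y \<in> S}"
    by (rule span_minimal[rotated])
qed (auto intro: span_diff span_base)

text \<open>If \<open>z\<close> in \<open>C\<close> is a difference \<open>a - b\<close> of points
  of \<open>F\<close>, then \<open>z\<close> is a summand of \<open>a = z + b\<close>, hence in
  \<open>F\<close>.\<close>

lemma face_of_convex_cone_eq:
  fixes F :: "'a::real_vector set"
  assumes C: "convex_cone C" and F: "F face_of C" "F \<noteq> {}"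
  shows "F = C \<inter> span F"
proof
  show "F \<subseteq> C \<inter> span F" using face_of_imp_subset[OF F(1)] span_superset by blast
  show "C \<inter> span F \<subseteq> F"
  proof
    fix z assume z: "z \<in> C \<inter> span F"
    then obtain a b where "z = a - b" "a \<in> F" "b \<in> F"
      using span_convex_cone[OF face_of_convex_cone[OF C F]] by blast
    then have "z + b \<in> F" by simp
    then show "z \<in> F"
      using face_of_convex_cone_summand[OF C F(1)] z \<open>b \<in> F\<close> face_of_imp_subset[OF F(1)] by blast
  qed
qed

text \<open>The generators form an indexed family, so that repeated columns of a matrix still count
  as separate indices.\<close>

definition finite_cone :: "'i set \<Rightarrow> ('i \<Rightarrow> 'a::real_vector) \<Rightarrow> 'a set" where
  "finite_cone I c = {\<Sum>i\<in>I. a i *\<^sub>R c i | a. \<forall>i\<in>I. 0 \<le> a i}"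

lemma finite_coneI: "(\<And>i. i \<in> I \<Longrightarrow> 0 \<le> a i) \<Longrightarrow> (\<Sum>i\<in>I. a i *\<^sub>R c i) \<in> finite_cone I c"
  unfolding finite_cone_def by blast

lemma finite_coneE:
  assumes "x \<in> finite_cone I c"
  obtains a where "\<And>i. i \<in> I \<Longrightarrow> 0 \<le> a i" "x = (\<Sum>i\<in>I. a i *\<^sub>R c i)"
  using assms unfolding finite_cone_def by blast

lemma convex_cone_finite_cone: "convex_cone (finite_cone I c)"
  unfolding convex_cone_iff
proof (intro conjI ballI allI impI)
  show "0 \<in> finite_cone I c"
    using finite_coneI[of I "\<lambda>_. 0" c] by simp
next
  fix x y assume "x \<in> finite_cone I c" "y \<in> finite_cone I c"
  then obtain a b where "\<And>i. i \<in> I \<Longrightarrow> 0 \<le> a i" "x = (\<Sum>i\<in>I. a i *\<^sub>R c i)"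
    "\<And>i. i \<in> I \<Longrightarrow> 0 \<le> b i" "y = (\<Sum>i\<in>I. b i *\<^sub>R c i)"
    by (metis finite_coneE)
  then show "x + y \<in> finite_cone I c"
    using finite_coneI[of I "\<lambda>i. a i + b i" c] by (simp add: scaleR_add_left sum.distrib)
next
  fix x and t :: real assume "x \<in> finite_cone I c" "0 \<le> t"
  then obtain a where "\<And>i. i \<in> I \<Longrightarrow> 0 \<le> a i" "x = (\<Sum>i\<in>I. a i *\<^sub>R c i)"
    by (metis finite_coneE)
  then show "t *\<^sub>R x \<in> finite_cone I c"
    using finite_coneI[of I "\<lambda>i. t * a i" c] \<open>0 \<le> t\<close> by (simp add: scaleR_sum_right)
qed

lemma finite_cone_mono:
  assumes "finite I" "J \<subseteq> I"
  shows "finite_cone J c \<subseteq> finite_cone I c"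
proof
  fix x assume "x \<in> finite_cone J c"
  then obtain a where a: "\<And>i. i \<in> J \<Longrightarrow> 0 \<le> a i" "x = (\<Sum>i\<in>J. a i *\<^sub>R c i)"
    by (metis finite_coneE)
  then have "x = (\<Sum>i\<in>I. (if i \<in> J then a i else 0) *\<^sub>R c i)"
    using assms by (auto intro!: sum.mono_neutral_cong_left)
  then show "x \<in> finite_cone I c"
    using a finite_coneI[of I "\<lambda>i. if i \<in> J then a i else 0" c] by auto
qed

lemma in_finite_cone:
  assumes "finite I" "i \<in> I"
  shows "c i \<in> finite_cone I c"
proof -
  have "c i \<in> finite_cone {i} c"
    using finite_coneI[of "{i}" "\<lambda>_. 1" c] by simp
  then show ?thesis using finite_cone_mono[of I "{i}" c] assms by blast
qed

lemma span_finite_cone: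
  assumes "finite I"
  shows "span (finite_cone I c) = span (c ` I)"
  unfolding span_eq
proof (intro conjI subsetI)
  fix x assume "x \<in> finite_cone I c"
  then obtain a where a: "x = (\<Sum>i\<in>I. a i *\<^sub>R c i)" by (metis finite_coneE)
  show "x \<in> span (c ` I)"
    unfolding a by (rule span_sum, rule span_scale, rule span_base, simp)
qed (use in_finite_cone[OF assms] span_base in fast)

text \<open>Once the term of \<open>j\<close> is split off, the rest is still a cone point, so both
  summands lie in the face.\<close>

lemma face_of_finite_cone_summand:
  assumes I: "finite I" and F: "F face_of finite_cone I c"
    and a: "\<And>i. i \<in> I \<Longrightarrow> 0 \<le> a i" "(\<Sum>i\<in>I. a i *\<^sub>R c i) \<in> F" and j: "j \<in> I" "0 < a j"
  shows "c j \<in> F"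
proof -
  note C = convex_cone_finite_cone[of I c]
  have cF: "convex_cone F" using face_of_convex_cone[OF C F] a by blast
  have "(\<Sum>i\<in>I. a i *\<^sub>R c i) = a j *\<^sub>R c j + (\<Sum>i\<in>I - {j}. a i *\<^sub>R c i)"
    using I j by (simp add: sum.remove)
  moreover have "(\<Sum>i\<in>I - {j}. a i *\<^sub>R c i) \<in> finite_cone I c"
    using finite_cone_mono[OF I, of "I - {j}" c] finite_coneI[of "I - {j}" a c] a by blast
  moreover have "a j *\<^sub>R c j \<in> finite_cone I c"
    using convex_cone_scaleR[OF C, of "a j" "c j"] in_finite_cone[OF I j(1), of c] j by simp
  ultimately have "a j *\<^sub>R c j \<in> F"
    using face_of_convex_cone_summand[OF C F] a(2) by metis
  then have "inverse (a j) *\<^sub>R a j *\<^sub>R c j \<in> F"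
    using convex_cone_scaleR[OF cF, of "inverse (a j)" "a j *\<^sub>R c j"] j by simp
  then show ?thesis using j by simp
qed

lemma face_of_finite_cone_span:
  assumes I: "finite I" and F: "F face_of finite_cone I c" "F \<noteq> {}"
  shows "span (c ` {i \<in> I. c i \<in> F}) = span F"
  unfolding span_eq
proof (intro conjI subsetI)
  fix x assume x: "x \<in> F"
  then obtain a where a: "\<And>i. i \<in> I \<Longrightarrow> 0 \<le> a i" "x = (\<Sum>i\<in>I. a i *\<^sub>R c i)"
    using face_of_imp_subset[OF F(1)] by (metis finite_coneE subsetD)
  have "a i *\<^sub>R c i \<in> span (c ` {i \<in> I. c i \<in> F})" if "i \<in> I" for i
  proof (cases "a i = 0")
    case False
    then have "c i \<in> F" using face_of_finite_cone_summand[OF I F(1), of a i] a x that by force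
    then show ?thesis using that by (intro span_scale span_base) auto
  qed (simp add: span_zero)
  then show "x \<in> span (c ` {i \<in> I. c i \<in> F})"
    unfolding a(2) by (rule span_sum)
qed (auto intro: span_base)

text \<open>Choosing such a \<open>J\<close> for each \<open>k\<close>-face embeds the
  \<open>k\<close>-faces into the \<open>k\<close>-subsets of \<open>I\<close>.\<close>

definition face_basis :: "'i set \<Rightarrow> ('i \<Rightarrow> 'a::real_vector) \<Rightarrow> nat \<Rightarrow> 'a set \<Rightarrow> 'i set \<Rightarrow> bool" where
  "face_basis I c k F J \<longleftrightarrow> J \<subseteq> I \<and> card J = k \<and> inj_on c J \<and> independent (c ` J) \<and>
     c ` J \<subseteq> F \<and> span (c ` J) = span F"

lemma has_aff_dim_nonempty: "has_aff_dim F k \<Longrightarrow> F \<noteq> {}"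
  unfolding has_aff_dim_def by auto

lemma face_basis_exists:
  assumes I: "finite I" and F: "F face_of finite_cone I c" "has_aff_dim F k"
  shows "\<exists>J. face_basis I c k F J"
proof -
  have ne: "F \<noteq> {}" using F(2) by (rule has_aff_dim_nonempty)
  have "0 \<in> F" using face_of_convex_cone[OF convex_cone_finite_cone F(1) ne] convex_cone_contains_0 by blast
  then obtain b where b: "independent b" "card b = k" "span b = span F"
    using F(2) has_aff_dim_iff_independent by blast
  \<comment> \<open>The generators lying on \<open>F\<close> already span it, so a maximal
    independent subset of them is a basis.\<close>
  obtain B where B: "B \<subseteq> c ` {i \<in> I. c i \<in> F}" "independent B" "c ` {i \<in> I. c i \<in> F} \<subseteq> span B"
    by (rule maximal_independent_subset)
  then have spB: "span B = span F"
    using face_of_finite_cone_span[OF I F(1) ne]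
    by (metis span_minimal span_mono subset_antisym subspace_span)
  then have "card B = k"
    using b B(2) by (metis dim_eq_card)
  moreover obtain J where "J \<subseteq> {i \<in> I. c i \<in> F}" "inj_on c J" "B = c ` J"
    using B(1)[unfolded subset_image_inj] by blast
  ultimately have "face_basis I c k F J"
    unfolding face_basis_def using B(2) spB by (auto simp: card_image)
  then show ?thesis by blast
qed

text \<open>A face of a cone is recovered from its span, so a set of generators that is a basis of
  the span of a face determines that face.\<close>

lemma face_basis_inj:
  assumes "F face_of finite_cone I c" "F \<noteq> {}" "F' face_of finite_cone I c" "F' \<noteq> {}"
    and "face_basis I c k F J" "face_basis I c k' F' J"
  shows "F = F'"
  using face_of_convex_cone_eq[OF convex_cone_finite_cone assms(1,2)]
    face_of_convex_cone_eq[OF convex_cone_finite_cone assms(3,4)] assms(5,6)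
  unfolding face_basis_def by metis

text \<open>Extending \<open>B'\<close> to a basis of \<open>span B\<close> adds nothing, since that
  basis also has \<open>card B\<close> elements.\<close>

lemma independent_same_card_span:
  assumes "independent B" "independent B'" "finite B" "B' \<subseteq> span B" "card B' = card B"
  shows "span B' = span B"
proof -
  have fin: "finite B'" using independent_span_bound[OF assms(3,2,4)] by blast
  obtain t where t: "card t = card B" "finite t" "B' \<subseteq> t" "t \<subseteq> span B" "B \<subseteq> span t"
  proof -
    obtain D where D: "B' \<subseteq> D" "D \<subseteq> span B" "independent D" "span B \<subseteq> span D"
      by (rule maximal_independent_subset_extend[OF assms(4,2)])
    then have "finite D \<and> card D = card B"
      using independent_span_bound[OF assms(3) D(3,2)] assms(1)
      by (metis D(2) D(4) dim_eq_card span_minimal subset_antisym subspace_span)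
    with D show ?thesis using that[of D] span_superset by blast
  qed
  then have "B' = t" using assms(5) by (metis card_subset_eq)
  then show ?thesis using t by (metis span_eq)
qed

text \<open>In terms of coefficients, a repetition \<open>c i = c j\<close> is just another
  nontrivial relation.\<close>

lemma inj_on_independent_iff:
  assumes "finite J"
  shows "inj_on c J \<and> independent (c ` J) \<longleftrightarrow>
    (\<forall>z. (\<Sum>i\<in>J. z i *\<^sub>R c i) = 0 \<longrightarrow> (\<forall>i\<in>J. z i = 0))"
proof (intro iffI allI impI ballI)
  fix z i assume inj: "inj_on c J \<and> independent (c ` J)" and 0: "(\<Sum>i\<in>J. z i *\<^sub>R c i) = 0" and i: "i \<in> J"
  have "(\<Sum>v\<in>c ` J. z (the_inv_into J c v) *\<^sub>R v) = 0"
    using inj 0 by (simp add: sum.reindex the_inv_into_f_f)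
  then have "z (the_inv_into J c (c i)) = 0"
    using inj i assms
    by (intro independentD[of "c ` J" "c ` J" "\<lambda>v. z (the_inv_into J c v)"]) auto
  then show "z i = 0" using inj i by (simp add: the_inv_into_f_f)
next
  assume *: "\<forall>z. (\<Sum>i\<in>J. z i *\<^sub>R c i) = 0 \<longrightarrow> (\<forall>i\<in>J. z i = 0)"
  have inj: "inj_on c J"
  proof (rule inj_onI, rule ccontr)
    fix i j assume ij: "i \<in> J" "j \<in> J" "c i = c j" "i \<noteq> j"
    have "(\<Sum>l\<in>J. ((if l = i then 1 else 0) - (if l = j then 1 else 0)) *\<^sub>R c l) = 0"
      using ij assms by (simp add: scaleR_diff_left sum_subtractf if_distrib[of "\<lambda>t. t *\<^sub>R _"] cong: if_cong)
    then show False using * ij by fastforce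
  qed
  moreover have "independent (c ` J)"
  proof (rule independent_if_scalars_zero)
    fix f v assume 0: "(\<Sum>v\<in>c ` J. f v *\<^sub>R v) = 0" "v \<in> c ` J"
    then show "f v = 0" using * inj by (auto simp: sum.reindex)
  qed (use assms in simp)
  ultimately show "inj_on c J \<and> independent (c ` J)" by blast
qed

text \<open>The choice \<open>g\<close> of a basis for each \<open>k\<close>-face is injective, so
  the count is maximal exactly when every \<open>k\<close>-subset is chosen. If \<open>J\<close> is
  chosen for \<open>F\<close> and a relation nonnegative off \<open>J\<close> is positive at some
  \<open>i\<close> off \<open>J\<close>, then \<open>c i\<close> lies in \<open>F\<close>, and an
  exchange gives a second \<open>k\<close>-subset with the same span, hence the same face.
  Conversely, the condition makes \<open>finite_cone J c\<close> a face that contains no generator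
  with index outside \<open>J\<close>.\<close>

theorem num_faces_finite_cone_eq_choose_iff:
  fixes c :: "'i \<Rightarrow> 'a::real_vector"
  assumes I: "finite I" and k: "1 \<le> k"
  shows "num_faces k (finite_cone I c) = card I choose k \<longleftrightarrow>
    (\<forall>J\<subseteq>I. card J = k \<longrightarrow>
       (\<forall>z. (\<forall>i\<in>I - J. 0 \<le> z i) \<and> (\<Sum>i\<in>I. z i *\<^sub>R c i) = 0 \<longrightarrow> (\<forall>i\<in>I. z i = 0)))"
    (is "_ \<longleftrightarrow> ?cond")
proof -
  let ?C = "finite_cone I c"
  note C = convex_cone_finite_cone[of I c]
  define Fs where "Fs = {F. F face_of ?C \<and> has_aff_dim F k}"
  define Js where "Js = {J. J \<subseteq> I \<and> card J = k}"
  define g where "g F = (SOME J. face_basis I c k F J)" for F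
  have ne: "F \<noteq> {}" if "F \<in> Fs" for F
    using that has_aff_dim_nonempty unfolding Fs_def by blast
  have g: "face_basis I c k F (g F)" if "F \<in> Fs" for F
    unfolding g_def using face_basis_exists[OF I] that unfolding Fs_def by (blast intro: someI_ex)
  have inj: "inj_on g Fs"
    using g ne face_basis_inj unfolding Fs_def by (smt (verit) inj_onI mem_Collect_eq)
  have sub: "g ` Fs \<subseteq> Js" using g unfolding face_basis_def Js_def by blast
  have finJs: "finite Js" unfolding Js_def using I by simp
  have "num_faces k ?C = card (g ` Fs)"
    unfolding num_faces_def Fs_def[symmetric] using inj by (simp add: card_image)
  moreover have "card Js = card I choose k"
    unfolding Js_def by (rule n_subsets[OF I])
  ultimately have "num_faces k ?C = card I choose k \<longleftrightarrow> g ` Fs = Js"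
    using card_subset_eq[OF finJs sub] by auto
  also have "\<dots> \<longleftrightarrow> ?cond"
  proof
    assume eq: "g ` Fs = Js"
    show ?cond
    proof (intro allI impI)
      fix J z assume J: "J \<subseteq> I" "card J = k" and
        z: "(\<forall>i\<in>I - J. 0 \<le> z i) \<and> (\<Sum>i\<in>I. z i *\<^sub>R c i) = 0"
      have "J \<in> g ` Fs" unfolding eq Js_def using J by blast
      then obtain F where F: "F \<in> Fs" "g F = J" by blast
      have F': "F face_of ?C" using F unfolding Fs_def by blast
      have fb: "inj_on c J" "independent (c ` J)" "c ` J \<subseteq> F" "span (c ` J) = span F"
        using g[OF F(1)] unfolding F(2) face_basis_def by auto
      have finJ: "finite J" using J I finite_subset by blast
      have split: "(\<Sum>i\<in>I. z i *\<^sub>R c i) = (\<Sum>i\<in>J. z i *\<^sub>R c i) + (\<Sum>i\<in>I - J. z i *\<^sub>R c i)"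
        using I J by (simp add: sum.subset_diff add.commute)
      \<comment> \<open>Dropping the coordinates in \<open>J\<close> leaves a point of the cone; as
        \<open>z\<close> is a relation, this point is also minus a combination over
        \<open>J\<close>, hence in \<open>span F\<close>.\<close>
      define a where "a i = (if i \<in> J then 0 else z i)" for i
      have a: "(\<Sum>i\<in>I. a i *\<^sub>R c i) = (\<Sum>i\<in>I - J. z i *\<^sub>R c i)"
        unfolding a_def using I by (intro sum.mono_neutral_cong_right) auto
      have a0: "0 \<le> a i" if "i \<in> I" for i using z that unfolding a_def by auto
      have "(\<Sum>i\<in>I. a i *\<^sub>R c i) = - (\<Sum>i\<in>J. z i *\<^sub>R c i)"
        unfolding a using z split by (simp add: eq_neg_iff_add_eq_0 add.commute)
      also have "\<dots> \<in> span F"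
        unfolding fb(4)[symmetric] by (rule span_neg, rule span_sum, rule span_scale, rule span_base, simp)
      finally have aF: "(\<Sum>i\<in>I. a i *\<^sub>R c i) \<in> F"
        using face_of_convex_cone_eq[OF C F' ne[OF F(1)]] finite_coneI[of I a c] a0 by blast
      have z0: "z i = 0" if i: "i \<in> I - J" for i
      proof (rule ccontr)
        assume "z i \<noteq> 0"
        then have "0 < a i" using z i unfolding a_def by force
        then have ciF: "c i \<in> F"
          using face_of_finite_cone_summand[OF I F' _ aF] a0 i by blast
        \<comment> \<open>Here \<open>1 \<le> k\<close> provides an index to exchange for
          \<open>i\<close>.\<close>
        obtain j where j: "j \<in> J" using J k by fastforce
        define J' where "J' = insert i (J - {j})"
        have J': "J' \<subseteq> I" "card J' = k" "i \<in> J'"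
          unfolding J'_def using i j J finJ k by (auto simp: card.insert_remove)
        have "J' \<in> g ` Fs" unfolding eq Js_def using J' by blast
        then obtain F2 where F2: "F2 \<in> Fs" "g F2 = J'" by blast
        then have fb2: "inj_on c J'" "independent (c ` J')" "span (c ` J') = span F2"
          using g[OF F2(1)] unfolding F2(2) face_basis_def by auto
        have "c ` J' \<subseteq> F" unfolding J'_def using ciF fb(3) by blast
        then have "c ` J' \<subseteq> span (c ` J)"
          unfolding fb(4) using span_superset by blast
        then have "span (c ` J') = span (c ` J)"
          using independent_same_card_span[OF fb(2) fb2(2)] fb(1) fb2(1) J J' finJ
          by (simp add: card_image)
        then have "F2 = F"
          using face_of_convex_cone_eq[OF C] F' F2 ne F(1) fb(4) fb2(3) unfolding Fs_def
          by (metis (mono_tags, lifting) mem_Collect_eq)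
        then show False using F F2 J' i by blast
      qed
      then have "(\<Sum>i\<in>J. z i *\<^sub>R c i) = 0" using z split by simp
      then have "\<forall>i\<in>J. z i = 0" using inj_on_independent_iff[OF finJ] fb by blast
      then show "\<forall>i\<in>I. z i = 0" using z0 by blast
    qed
  next
    assume cond: ?cond
    have "J \<in> g ` Fs" if "J \<in> Js" for J
    proof -
      have J: "J \<subseteq> I" "card J = k" using that unfolding Js_def by auto
      have finJ: "finite J" using J I finite_subset by blast
      have condJ: "i \<in> I \<Longrightarrow> z i = 0" if "\<And>i. i \<in> I - J \<Longrightarrow> 0 \<le> z i" "(\<Sum>i\<in>I. z i *\<^sub>R c i) = 0" for z i
        using cond J that by blast
      define F where "F = finite_cone J c"
      have ext: "(\<Sum>i\<in>I. (if i \<in> J then z i else 0) *\<^sub>R c i) = (\<Sum>i\<in>J. z i *\<^sub>R c i)" for z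
        using I J by (intro sum.mono_neutral_cong_right) auto
      have indep: "inj_on c J \<and> independent (c ` J)"
        unfolding inj_on_independent_iff[OF finJ]
      proof (intro allI impI ballI)
        fix z i assume "(\<Sum>i\<in>J. z i *\<^sub>R c i) = 0" "i \<in> J"
        then show "z i = 0" using condJ[of "\<lambda>i. if i \<in> J then z i else 0" i] J ext by auto
      qed
      \<comment> \<open>A representation over \<open>I\<close> and one over \<open>J\<close> of the
        same point differ by a relation that is nonnegative off \<open>J\<close>, and
        \<open>condJ\<close> makes it vanish.\<close>
      have supp: "i \<in> J" if "i \<in> I" "0 < \<alpha> i" "\<And>i. i \<in> I \<Longrightarrow> 0 \<le> \<alpha> i" "(\<Sum>i\<in>I. \<alpha> i *\<^sub>R c i) \<in> F" for \<alpha> i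
      proof (rule ccontr)
        assume "i \<notin> J"
        obtain \<gamma> where \<gamma>: "(\<Sum>i\<in>I. \<alpha> i *\<^sub>R c i) = (\<Sum>i\<in>J. \<gamma> i *\<^sub>R c i)"
          using \<open>_ \<in> F\<close> unfolding F_def by (metis finite_coneE)
        have "(\<Sum>i\<in>I. (\<alpha> i - (if i \<in> J then \<gamma> i else 0)) *\<^sub>R c i) = 0"
          unfolding scaleR_diff_left sum_subtractf ext using \<gamma> by simp
        then have "\<alpha> i - (if i \<in> J then \<gamma> i else 0) = 0"
          using that by (intro condJ[of "\<lambda>i. \<alpha> i - (if i \<in> J then \<gamma> i else 0)"]) auto
        then show False using that \<open>i \<notin> J\<close> by simp
      qed
      have restrict: "(\<Sum>i\<in>I. \<alpha> i *\<^sub>R c i) \<in> F" 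
        if "\<And>i. i \<in> I \<Longrightarrow> 0 \<le> \<alpha> i" "\<And>i. i \<in> I - J \<Longrightarrow> \<alpha> i = 0" for \<alpha>
      proof -
        have "(\<Sum>i\<in>I. \<alpha> i *\<^sub>R c i) = (\<Sum>i\<in>J. \<alpha> i *\<^sub>R c i)"
          using I J that by (intro sum.mono_neutral_right) auto
        then show ?thesis unfolding F_def using finite_coneI[of J \<alpha> c] that J by auto
      qed
      have face: "F face_of ?C"
        unfolding face_of_def
      proof (intro conjI ballI impI)
        show "F \<subseteq> ?C" unfolding F_def using finite_cone_mono[OF I] J by blast
        show "convex F" unfolding F_def using convex_cone_finite_cone[of J c] by (simp add: convex_cone_def)
      next
        fix a b x assume "a \<in> ?C" "b \<in> ?C" "x \<in> F" "x \<in> open_segment a b"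
        obtain u where u: "0 < u" "u < 1" "x = (1 - u) *\<^sub>R a + u *\<^sub>R b"
          using \<open>x \<in> open_segment a b\<close> unfolding in_segment by blast
        obtain \<alpha> where \<alpha>: "\<And>i. i \<in> I \<Longrightarrow> 0 \<le> \<alpha> i" "a = (\<Sum>i\<in>I. \<alpha> i *\<^sub>R c i)"
          using \<open>a \<in> ?C\<close> by (rule finite_coneE) blast
        obtain \<beta> where \<beta>: "\<And>i. i \<in> I \<Longrightarrow> 0 \<le> \<beta> i" "b = (\<Sum>i\<in>I. \<beta> i *\<^sub>R c i)"
          using \<open>b \<in> ?C\<close> by (rule finite_coneE) blast
        have x: "x = (\<Sum>i\<in>I. ((1 - u) * \<alpha> i + u * \<beta> i) *\<^sub>R c i)"
          unfolding u \<alpha> \<beta> by (simp add: scaleR_sum_right scaleR_add_left sum.distrib)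
        have "\<alpha> i = 0 \<and> \<beta> i = 0" if i: "i \<in> I - J" for i
        proof (rule ccontr)
          assume "\<not> (\<alpha> i = 0 \<and> \<beta> i = 0)"
          then have "0 < \<alpha> i \<or> 0 < \<beta> i" using \<alpha>(1)[of i] \<beta>(1)[of i] i by auto
          then have "0 < (1 - u) * \<alpha> i + u * \<beta> i"
            using u \<alpha>(1)[of i] \<beta>(1)[of i] i by (auto intro: add_pos_nonneg add_nonneg_pos)
          then have "i \<in> J"
            using supp[of i "\<lambda>i. (1 - u) * \<alpha> i + u * \<beta> i"] \<open>x \<in> F\<close>[unfolded x] i u \<alpha>(1) \<beta>(1) by simp
          then show False using i by blast
        qed
        then show "a \<in> F" "b \<in> F"
          unfolding \<alpha> \<beta> using restrict[of \<alpha>] restrict[of \<beta>] \<alpha>(1) \<beta>(1) by blast+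
      qed
      have spF: "span (c ` J) = span F" unfolding F_def using span_finite_cone[OF finJ, of c] by simp
      have "0 \<in> F" unfolding F_def using convex_cone_finite_cone convex_cone_contains_0 by blast
      then have "has_aff_dim F k"
        using has_aff_dim_iff_independent[of F k] indep spF finJ J(2) card_image[of c J] by blast
      then have FFs: "F \<in> Fs" unfolding Fs_def using face by blast
      \<comment> \<open>\<open>g\<close> picks an unspecified basis, so every generator lying on
        \<open>F\<close> has to be shown to have its index in \<open>J\<close>.\<close>
      have "g F \<subseteq> J"
      proof
        fix i assume "i \<in> g F"
        then have i: "i \<in> I" "c i \<in> F" using g[OF FFs] unfolding face_basis_def by auto
        have "(\<Sum>l\<in>I. (if l = i then 1 else 0) *\<^sub>R c l) = c i"
          using I i by (simp add: if_distrib[of "\<lambda>t. t *\<^sub>R _"] cong: if_cong)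
        then show "i \<in> J" using supp[of i "\<lambda>l. if l = i then 1 else 0"] i by simp
      qed
      moreover have "card (g F) = card J" using g[OF FFs] J unfolding face_basis_def by simp
      ultimately have "g F = J" using finJ card_subset_eq by blast
      then show ?thesis using FFs by blast
    qed
    then show "g ` Fs = Js" using sub by blast
  qed
  finally show ?thesis .
qed

section \<open>Sign patterns attained on a subspace\<close>

text \<open>Pascal's rule in the form that matches the removal of one functional in the pattern
  count.\<close>

lemma sum_choose_Suc:
  "(\<Sum>l\<le>Suc m. Suc n choose l) = (\<Sum>l\<le>Suc m. n choose l) + (\<Sum>l\<le>m. n choose l)"
proof -
  have "(\<Sum>l\<le>Suc m. Suc n choose l) = 1 + (\<Sum>l\<le>m. Suc n choose Suc l)"
    by (subst sum.atMost_Suc_shift) simp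
  also have "\<dots> = (1 + (\<Sum>l\<le>m. n choose Suc l)) + (\<Sum>l\<le>m. n choose l)"
    by (simp add: sum.distrib)
  also have "1 + (\<Sum>l\<le>m. n choose Suc l) = (\<Sum>l\<le>Suc m. n choose l)"
    by (subst sum.atMost_Suc_shift) simp
  finally show ?thesis .
qed

text \<open>The projection along \<open>w\<close> onto the kernel of \<open>f\<close> sends
  \<open>w\<close> to 0 and fixes \<open>y\<close>. One spanning vector is thus saved, which serves
  as the drop in dimension.\<close>

lemma span_inter_kernel:
  fixes f :: "'a::real_vector \<Rightarrow> real"
  assumes f: "linear f" and w: "w \<in> S" "f w \<noteq> 0" and y: "y \<in> span S" "f y = 0"
  shows "y \<in> span ((\<lambda>v. v - (f v / f w) *\<^sub>R w) ` (S - {w}))"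
proof -
  let ?T = "\<lambda>v. v - (f v / f w) *\<^sub>R w"
  have T: "linear ?T"
    by (intro linearI) (simp_all add: linear_add[OF f] linear_scale[OF f] algebra_simps add_divide_distrib)
  obtain r where r: "y - r *\<^sub>R w \<in> span (S - {w})"
    using span_breakdown[OF w(1) y(1)] by blast
  have "f (y - r *\<^sub>R w) / f w = - r"
    using y(2) w(2) by (simp add: linear_diff[OF f] linear_scale[OF f])
  then have "y = ?T (y - r *\<^sub>R w)" by simp
  then have "y \<in> ?T ` span (S - {w})" using r by (rule image_eqI)
  then show ?thesis using linear_span_image[OF T] by simp
qed

text \<open>These are the chambers that the hyperplanes \<open>\<phi> i = 0\<close> cut out in
  \<open>V\<close>, each labelled by the functionals positive on it. If some functional vanishes on
  \<open>V\<close> there are none.\<close>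

definition strict_patterns :: "'i set \<Rightarrow> ('i \<Rightarrow> 'a \<Rightarrow> real) \<Rightarrow> 'a set \<Rightarrow> 'i set set" where
  "strict_patterns I \<phi> V =
     {s \<in> Pow I. \<exists>y\<in>V. (\<forall>i\<in>s. 0 < \<phi> i y) \<and> (\<forall>i\<in>I - s. \<phi> i y < 0)}"

text \<open>The induction removes one functional: a pattern of the others that extends in both ways is,
  by convexity, already attained on the kernel of the removed functional, whose dimension is one less.\<close>

lemma card_strict_patterns_le:
  fixes \<phi> :: "'i \<Rightarrow> 'a::real_vector \<Rightarrow> real"
  assumes "finite I" and "\<And>i. i \<in> I \<Longrightarrow> linear (\<phi> i)" and "finite S" and "card S \<le> m"
  shows "card (strict_patterns I \<phi> (span S)) \<le> (\<Sum>l\<le>m. card I choose l)"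
  using assms
proof (induction I arbitrary: S m rule: finite_induct)
  case empty
  have "strict_patterns {} \<phi> (span S) \<subseteq> {{}}" unfolding strict_patterns_def by auto
  then have "card (strict_patterns {} \<phi> (span S)) \<le> card {{} :: 'i set}"
    by (intro card_mono) auto
  also have "\<dots> \<le> (\<Sum>l\<le>m. card ({} :: 'i set) choose l)"
    by (simp add: sum.atMost_shift)
  finally show ?case .
next
  case (insert x I)
  let ?A = "strict_patterns (insert x I) \<phi> (span S)"
  show ?case
  proof (cases "\<exists>w\<in>S. \<phi> x w \<noteq> 0")
    case False
    have "\<phi> x y = 0" if "y \<in> span S" for y
    proof (rule linear_eq_0_on_span[OF _ _ that])
      show "linear (\<phi> x)" using insert by blast
    qed (use False in blast)
    moreover have False if "s \<in> ?A" "\<And>y. y \<in> span S \<Longrightarrow> \<phi> x y = 0" for s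
    proof -
      obtain y where "y \<in> span S" "\<forall>i\<in>s. 0 < \<phi> i y" "\<forall>i\<in>insert x I - s. \<phi> i y < 0"
        using \<open>s \<in> ?A\<close> unfolding strict_patterns_def by blast
      then show False using that(2)[of y] by (metis DiffI insertI1 less_irrefl)
    qed
    ultimately have "?A = {}" by blast
    then show ?thesis by simp
  next
    case True
    then obtain w where w: "w \<in> S" "\<phi> x w \<noteq> 0" by blast
    then obtain m' where m: "m = Suc m'"
      using insert.prems by (metis card_eq_0_iff empty_iff le_zero_eq not0_implies_Suc)
    define S' where "S' = (\<lambda>v. v - (\<phi> x v / \<phi> x w) *\<^sub>R w) ` (S - {w})"
    have "card S' \<le> card (S - {w})" unfolding S'_def using insert.prems by (intro card_image_le) simp
    then have S': "finite S'" "card S' \<le> m'"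
      using insert.prems w m unfolding S'_def by auto
    have S'_sub: "span S' \<subseteq> span S"
    proof (rule span_minimal)
      show "S' \<subseteq> span S"
        unfolding S'_def using w by (auto intro!: span_diff span_scale intro: span_base)
    qed simp
    define A1 where "A1 = {s \<in> ?A. x \<notin> s}"
    define A2 where "A2 = {s \<in> ?A. x \<in> s}"
    define B where "B = (\<lambda>s. s - {x}) ` A2"
    have finA: "finite ?A"
      using insert.hyps unfolding strict_patterns_def by simp
    have finP: "finite (strict_patterns I \<phi> V)" for V
      using insert.hyps unfolding strict_patterns_def by simp
    have A: "?A = A1 \<union> A2" "A1 \<inter> A2 = {}" unfolding A1_def A2_def by auto
    have fin: "finite A1" "finite A2" using finA A by auto
    have "inj_on (\<lambda>s. s - {x}) A2" unfolding A2_def by (rule inj_onI) blast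
    then have cB: "card B = card A2" unfolding B_def by (rule card_image)
    have "card ?A = card A1 + card B"
      unfolding cB A(1) using fin A(2) by (rule card_Un_disjoint)
    \<comment> \<open>\<open>A1\<close> and \<open>B\<close> are the patterns on \<open>I\<close>
      that extend by a negative and by a positive value at \<open>x\<close>; the overlap consists of
      those that extend both ways.\<close>
    also have "\<dots> = card (A1 \<union> B) + card (A1 \<inter> B)"
      using fin by (intro card_Un_Int) (auto simp: B_def)
    also have "card (A1 \<union> B) \<le> card (strict_patterns I \<phi> (span S))"
    proof (rule card_mono[OF finP])
      show "A1 \<union> B \<subseteq> strict_patterns I \<phi> (span S)"
        unfolding A1_def B_def A2_def strict_patterns_def using insert.hyps(2) by blast
    qed
    also have "card (A1 \<inter> B) \<le> card (strict_patterns I \<phi> (span S'))"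
    proof (rule card_mono[OF finP], rule subsetI)
      fix s assume s: "s \<in> A1 \<inter> B"
      then have sI: "s \<subseteq> I" "x \<notin> s" unfolding A1_def strict_patterns_def by auto
      obtain y where y: "y \<in> span S" "\<forall>i\<in>s. 0 < \<phi> i y" "\<forall>i\<in>I - s. \<phi> i y < 0" "\<phi> x y < 0"
        using s unfolding A1_def strict_patterns_def by blast
      obtain t where t: "t \<in> A2" "s = t - {x}" using s unfolding B_def by blast
      then obtain y' where y't: "y' \<in> span S" "\<forall>i\<in>t. 0 < \<phi> i y'" "\<forall>i\<in>insert x I - t. \<phi> i y' < 0" "x \<in> t"
        unfolding A2_def strict_patterns_def by blast
      have y': "y' \<in> span S" "\<forall>i\<in>s. 0 < \<phi> i y'" "\<forall>i\<in>I - s. \<phi> i y' < 0" "0 < \<phi> x y'"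
        using y't t(2) insert.hyps(2) by blast+
      \<comment> \<open>Both coefficients are positive and they cancel \<open>\<phi> x\<close>; the
        signs that \<open>y\<close> and \<open>y'\<close> share on \<open>I\<close> survive.\<close>
      define z where "z = \<phi> x y' *\<^sub>R y + (- \<phi> x y) *\<^sub>R y'"
      have lz: "\<phi> i z = \<phi> x y' * \<phi> i y + (- \<phi> x y) * \<phi> i y'" if "i \<in> insert x I" for i
      proof -
        note l = insert.prems(1)[OF that]
        show ?thesis unfolding z_def by (simp add: linear_add[OF l] linear_diff[OF l] linear_scale[OF l])
      qed
      have "z \<in> span S'"
        unfolding S'_def
      proof (rule span_inter_kernel)
        show "linear (\<phi> x)" using insert by blast
        show "z \<in> span S" unfolding z_def using y y' by (intro span_add span_scale)
        show "\<phi> x z = 0" using lz[of x] by simp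
      qed (use w in auto)
      moreover have "0 < \<phi> i z" if "i \<in> s" for i
      proof -
        have "0 < \<phi> x y' * \<phi> i y" "0 < (- \<phi> x y) * \<phi> i y'"
          using y y' that by (intro mult_pos_pos; simp)+
        then show ?thesis using lz[of i] that sI by auto
      qed
      moreover have "\<phi> i z < 0" if "i \<in> I - s" for i
      proof -
        have "\<phi> x y' * \<phi> i y < 0" "(- \<phi> x y) * \<phi> i y' < 0"
          using y y' that by (intro mult_pos_neg; simp)+
        then show ?thesis using lz[of i] that by auto
      qed
      ultimately show "s \<in> strict_patterns I \<phi> (span S')"
        unfolding strict_patterns_def using sI by blast
    qed
    also have "card (strict_patterns I \<phi> (span S)) \<le> (\<Sum>l\<le>m. card I choose l)"
      using insert by blast
    also have "card (strict_patterns I \<phi> (span S')) \<le> (\<Sum>l\<le>m'. card I choose l)"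
      using insert S' by blast
    also have "(\<Sum>l\<le>m. card I choose l) + (\<Sum>l\<le>m'. card I choose l) = (\<Sum>l\<le>m. card (insert x I) choose l)"
      unfolding m card_insert_disjoint[OF insert.hyps] by (rule sum_choose_Suc[symmetric])
    finally show ?thesis by simp
  qed
qed

section \<open>Measurability of projections along a compact set\<close>

text \<open>The uncountable union over \<open>K\<close> is made countable: by continuity and
  compactness a zero exists iff the values on a countable dense subset come arbitrarily close to
  0.\<close>

lemma sets_ex_zero_compact:
  fixes g :: "'x \<Rightarrow> 'b::{metric_space, second_countable_topology} \<Rightarrow> real"
  assumes K: "compact K"
    and meas: "\<And>y. y \<in> K \<Longrightarrow> (\<lambda>x. g x y) \<in> borel_measurable M"
    and cont: "\<And>x. x \<in> space M \<Longrightarrow> continuous_on K (g x)"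
    and nonneg: "\<And>x y. x \<in> space M \<Longrightarrow> y \<in> K \<Longrightarrow> 0 \<le> g x y"
  shows "{x \<in> space M. \<exists>y\<in>K. g x y = 0} \<in> sets M"
proof -
  obtain D where D: "countable D" "D \<subseteq> K" "K \<subseteq> closure D"
    using separable by blast
  have "{x \<in> space M. \<exists>y\<in>K. g x y = 0} = (\<Inter>m. \<Union>q\<in>D. {x \<in> space M. g x q < 1 / real (Suc m)})"
    (is "?L = ?R")
  proof (intro subset_antisym subsetI)
    fix x assume "x \<in> ?L"
    then obtain y where y: "x \<in> space M" "y \<in> K" "g x y = 0" by blast
    then obtain d where d: "\<And>n. d n \<in> D" "d \<longlonglongrightarrow> y"
      using D closure_sequential by blast
    have "\<forall>\<^sub>F n in sequentially. d n \<in> K" using d(1) D(2) by (simp add: subset_iff)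
    then have "(\<lambda>n. g x (d n)) \<longlonglongrightarrow> g x y"
      by (rule continuous_on_tendsto_compose[OF cont[OF y(1)] d(2) y(2)])
    then have "\<forall>\<^sub>F n in sequentially. g x (d n) < 1 / real (Suc m)" for m
      using y(3) order_tendstoD(2)[of "\<lambda>n. g x (d n)" 0] by simp
    then have "\<exists>n. g x (d n) < 1 / real (Suc m)" for m
      using eventually_happens by fastforce
    then show "x \<in> ?R" using y(1) d(1) by fast
  next
    fix x assume x: "x \<in> ?R"
    then have xM: "x \<in> space M" and "K \<noteq> {}" using D(2) by fastforce+
    then obtain y where y: "y \<in> K" "\<And>z. z \<in> K \<Longrightarrow> g x y \<le> g x z"
      using continuous_attains_inf[OF K _ cont[OF xM]] by blast
    have "g x y \<le> inverse (real (Suc m))" for m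
    proof -
      obtain q where "q \<in> D" "g x q < 1 / real (Suc m)" using x by blast
      then show ?thesis using y(2)[of q] D(2) by (auto simp: inverse_eq_divide)
    qed
    then have "g x y \<le> 0" using LIMSEQ_inverse_real_of_nat LIMSEQ_le_const by blast
    then show "x \<in> ?L" using nonneg[OF xM y(1)] xM y(1) by force
  qed
  also have "\<dots> \<in> sets M"
  proof (intro sets.countable_INT sets.countable_UN'[OF D(1)] image_subsetI UNIV_I)
    fix m q assume "q \<in> D"
    then have "(\<lambda>x. g x q) \<in> borel_measurable M" using meas D(2) by blast
    then show "{x \<in> space M. g x q < 1 / real (Suc m)} \<in> sets M"
      by (rule borel_measurable_less) simp
  qed auto
  finally show ?thesis .
qed

text \<open>Fixing the coordinates from \<open>d\<close> on makes the set compact among functions on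
  all naturals. It represents, up to positive scaling, the nonzero vectors that are nonnegative on
  \<open>P\<close>.\<close>

definition l1_sphere :: "nat \<Rightarrow> nat set \<Rightarrow> (nat \<Rightarrow> real) set" where
  "l1_sphere d P = {z. (\<forall>i\<ge>d. z i = 0) \<and> (\<forall>i\<in>P. 0 \<le> z i) \<and> (\<Sum>i<d. \<bar>z i\<bar>) = 1}"

lemma compact_l1_sphere: "compact (l1_sphere d P)"
proof -
  define Q where "Q = PiE UNIV (\<lambda>i. if i < d then {-1..1::real} else {0})"
  have "compactin (product_topology (\<lambda>i. euclidean) UNIV) Q"
    unfolding Q_def compactin_PiE by simp
  then have Q: "compact Q" by (simp add: euclidean_product_topology)
  have "l1_sphere d P = Q \<inter> ((\<Inter>i\<in>P. {z. 0 \<le> z i}) \<inter> {z. (\<Sum>i<d. \<bar>z i\<bar>) = 1})"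
  proof -
    have "z \<in> Q" if "z \<in> l1_sphere d P" for z
    proof -
      have "\<bar>z i\<bar> \<le> 1" if "i < d" for i
        using member_le_sum[of i "{..<d}" "\<lambda>i. \<bar>z i\<bar>"] that \<open>z \<in> l1_sphere d P\<close>
        by (simp add: l1_sphere_def)
      then show ?thesis using that unfolding Q_def l1_sphere_def by (auto simp: abs_le_iff minus_le_iff)
    qed
    moreover have "z i = 0" if "z \<in> Q" "d \<le> i" for z i
      using PiE_mem[OF that(1)[unfolded Q_def], of i] that(2) by simp
    ultimately show ?thesis unfolding l1_sphere_def by auto
  qed
  moreover have "closed ((\<Inter>i\<in>P. {z. 0 \<le> z i}) \<inter> {z :: nat \<Rightarrow> real. (\<Sum>i<d. \<bar>z i\<bar>) = 1})"
    by (intro closed_Int closed_INT ballI closed_Collect_le closed_Collect_eq continuous_intros) auto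
  ultimately show ?thesis using compact_Int_closed[OF Q] by metis
qed

text \<open>\<open>scale\<close> permits normalisation, and \<open>cong\<close> permits resetting
  the coordinates from \<open>d\<close> on to 0.\<close>

lemma ex_l1_sphere_iff:
  assumes P: "P \<subseteq> {..<d}"
    and scale: "\<And>z t. 0 < t \<Longrightarrow> Q z \<Longrightarrow> Q (\<lambda>i. t * z i)"
    and cong: "\<And>z z'. Q z \<Longrightarrow> (\<And>i. i < d \<Longrightarrow> z i = z' i) \<Longrightarrow> Q z'"
  shows "(\<exists>z\<in>l1_sphere d P. Q z) \<longleftrightarrow> (\<exists>z. (\<forall>i\<in>P. 0 \<le> z i) \<and> (\<exists>i<d. z i \<noteq> 0) \<and> Q z)"
proof
  assume "\<exists>z\<in>l1_sphere d P. Q z"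
  then obtain z where z: "z \<in> l1_sphere d P" "Q z" by blast
  have False if "\<forall>i<d. z i = 0" using z(1) that unfolding l1_sphere_def by simp
  then show "\<exists>z. (\<forall>i\<in>P. 0 \<le> z i) \<and> (\<exists>i<d. z i \<noteq> 0) \<and> Q z"
    using z unfolding l1_sphere_def by blast
next
  assume "\<exists>z. (\<forall>i\<in>P. 0 \<le> z i) \<and> (\<exists>i<d. z i \<noteq> 0) \<and> Q z"
  then obtain z j where z: "\<forall>i\<in>P. 0 \<le> z i" "j < d" "z j \<noteq> 0" "Q z" by blast
  define s where "s = (\<Sum>i<d. \<bar>z i\<bar>)"
  have s: "0 < s" unfolding s_def using z by (intro sum_pos2[of _ j]) auto
  define w where "w i = (if i < d then (1 / s) * z i else 0)" for i
  have "(\<Sum>i<d. \<bar>w i\<bar>) = (\<Sum>i<d. \<bar>z i\<bar>) / s"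
    using s by (simp add: w_def abs_mult sum_divide_distrib)
  then have "w \<in> l1_sphere d P"
    unfolding l1_sphere_def using z s P by (auto simp: w_def s_def)
  moreover have "Q w"
    using cong[OF scale[OF _ z(4)], of "1 / s" w] s by (simp add: w_def)
  ultimately show "\<exists>z\<in>l1_sphere d P. Q z" by blast
qed

section \<open>The exponent\<close>

lemma shannon_H_eq: "shannon_H x = - x * ln x - (1 - x) * ln (1 - x)"
  unfolding shannon_H_def by (cases "x = 0") (auto simp: ln_div)

lemma continuous_on_x_ln_x: "continuous_on {0..1} (\<lambda>x::real. x * ln x)"
  unfolding continuous_on_eq_continuous_within
proof
  fix x :: real assume x: "x \<in> {0..1}"
  show "continuous (at x within {0..1}) (\<lambda>x. x * ln x)"
  proof (cases "x = 0")
    case True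
    \<comment> \<open>The convention \<open>ln 0 = 0\<close> gives the value 0 at 0, which is also
      the limit.\<close>
    have "((\<lambda>x::real. x * ln x) \<longlongrightarrow> 0) (at_right 0)" by real_asymp
    then show ?thesis unfolding True continuous_within by (simp add: at_within_Icc_at_right)
  next
    case False
    then show ?thesis using x by (intro continuous_intros) auto
  qed
qed

lemma continuous_on_shannon_H: "continuous_on {0..1} shannon_H"
proof -
  have "continuous_on {0..1} (\<lambda>x::real. (1 - x) * ln (1 - x))"
    by (rule continuous_on_compose2[OF continuous_on_x_ln_x]) (auto intro!: continuous_intros)
  then have "continuous_on {0..1} (\<lambda>x::real. - (x * ln x) - (1 - x) * ln (1 - x))"
    using continuous_on_x_ln_x by (intro continuous_on_diff continuous_on_minus)
  then show ?thesis by (simp add: shannon_H_eq[abs_def])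
qed

lemma shannon_H_nonneg:
  assumes "0 \<le> x" "x \<le> 1" shows "0 \<le> shannon_H x"
proof -
  have *: "t * ln t \<le> 0" if "0 \<le> t" "t \<le> 1" for t :: real
    using that by (cases "t = 0") (auto simp: mult_nonneg_nonpos)
  show ?thesis unfolding shannon_H_eq using *[of x] *[of "1 - x"] assms by simp
qed

text \<open>Gibbs' inequality against the uniform distribution, with \<open>ln t \<le> t - 1\<close>
  applied to both terms.\<close>

lemma shannon_H_le_ln_2:
  assumes "0 < x" "x < 1" shows "shannon_H x \<le> ln 2"
proof -
  have l: "ln (1 / (2 * y)) = - ln 2 - ln y" if "0 < y" for y :: real
    using that by (simp add: ln_div ln_mult)
  have l': "ln (1 / (2 * (1 - x))) = - ln 2 - ln (1 - x)" using assms by (intro l) simp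
  have "shannon_H x - ln 2 = x * ln (1 / (2 * x)) + (1 - x) * ln (1 / (2 * (1 - x)))"
    unfolding shannon_H_eq l[OF assms(1)] l'
    by (simp add: algebra_simps)
  also have "\<dots> \<le> x * (1 / (2 * x) - 1) + (1 - x) * (1 / (2 * (1 - x)) - 1)"
    using assms by (intro add_mono mult_left_mono ln_le_minus_one) auto
  also have "\<dots> = 0" using assms by (simp add: field_simps)
  finally show ?thesis by simp
qed

section \<open>The zero crossing of the exponent\<close>

lemma continuous_on_psi_S: "continuous_on {0..1} (psi_S \<delta>)"
  unfolding psi_S_def[abs_def] by (intro continuous_intros continuous_on_shannon_H)

lemma psi_S_has_derivative:
  assumes "0 < x" "x < 1"
  shows "(psi_S \<delta> has_real_derivative \<delta> * (ln (1 - x) - ln x) + \<delta> * ln 2) (at x)"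
proof -
  have "(shannon_H has_real_derivative - ln x - x * inverse x - (- ln (1 - x) - (1 - x) * inverse (1 - x))) (at x)"
    unfolding shannon_H_eq[abs_def]
    using assms by (auto intro!: derivative_eq_intros)
  then have "(shannon_H has_real_derivative ln (1 - x) - ln x) (at x)" using assms by simp
  then show ?thesis
    unfolding psi_S_def[abs_def] by (auto intro!: derivative_eq_intros)
qed

lemma psi_S_zero:
  assumes "1/2 \<le> \<delta>" "\<delta> < 1" shows "psi_S \<delta> 0 \<le> 0"
  using shannon_H_le_ln_2[of \<delta>] assms by (simp add: psi_S_def shannon_H_0_1)

text \<open>Since \<open>1 - \<delta> \<le> 1/2\<close>, the entropy term of
  \<open>1 - \<delta>\<close> alone absorbs \<open>(1 - \<delta>) * ln 2\<close>, and the term of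
  \<open>\<delta>\<close> is left over.\<close>

lemma psi_S_one:
  assumes "1/2 \<le> \<delta>" "\<delta> < 1" shows "0 < psi_S \<delta> 1"
proof -
  have "psi_S \<delta> 1 = \<delta> * (- ln \<delta>) + (1 - \<delta>) * (- ln (1 - \<delta>) - ln 2)"
    unfolding psi_S_def shannon_H_eq by (simp add: algebra_simps)
  moreover have "ln (1 - \<delta>) \<le> ln (1/2)" using assms by (subst ln_le_cancel_iff) auto
  then have "0 \<le> - ln (1 - \<delta>) - ln 2" by (simp add: ln_div)
  moreover have "0 < \<delta> * (- ln \<delta>)" using assms by (intro mult_pos_pos) auto
  moreover have "0 \<le> (1 - \<delta>) * (- ln (1 - \<delta>) - ln 2)"
    using assms \<open>0 \<le> - ln (1 - \<delta>) - ln 2\<close> by (intro mult_nonneg_nonneg) auto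
  ultimately show ?thesis by linarith
qed

text \<open>The derivative is strictly decreasing inside the interval. It vanishes between two
  zeros, yet is positive somewhere between the larger one and 1, because
  \<open>psi_S \<delta> 1\<close> is positive. The mean value theorem tolerates the infinite slopes
  at 0 and 1.\<close>

lemma psi_S_zero_unique:
  assumes \<delta>: "1/2 \<le> \<delta>" "\<delta> < 1"
    and a: "0 \<le> a" "a \<le> 1" "psi_S \<delta> a = 0" and b: "0 \<le> b" "b \<le> 1" "psi_S \<delta> b = 0"
  shows "a = b"
proof -
  have False if ab: "a < b" "0 \<le> a" "b \<le> 1" "psi_S \<delta> a = 0" "psi_S \<delta> b = 0" for a b
  proof -
    let ?d = "\<lambda>x. \<delta> * (ln (1 - x) - ln x) + \<delta> * ln 2"
    have b1: "b < 1" using ab psi_S_one[OF \<delta>] by (cases "b = 1") auto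
    have mvt: "\<exists>l z. u < z \<and> z < v \<and> (psi_S \<delta> has_real_derivative l) (at z) \<and>
       psi_S \<delta> v - psi_S \<delta> u = (v - u) * l" if "u < v" "0 \<le> u" "v \<le> 1" for u v
    proof (rule MVT)
      show "continuous_on {u..v} (psi_S \<delta>)"
        using continuous_on_psi_S by (rule continuous_on_subset) (use that in auto)
    next
      fix x assume "u < x" "x < v"
      then show "psi_S \<delta> differentiable (at x)"
        using psi_S_has_derivative[of x \<delta>] that unfolding real_differentiable_def by force
    qed (fact that(1))
    obtain l \<xi> where \<xi>: "a < \<xi>" "\<xi> < b" "(psi_S \<delta> has_real_derivative l) (at \<xi>)" "0 = (b - a) * l"
      using mvt[of a b] ab by auto
    obtain l' \<eta> where \<eta>: "b < \<eta>" "\<eta> < 1" "(psi_S \<delta> has_real_derivative l') (at \<eta>)"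
      "psi_S \<delta> 1 = (1 - b) * l'"
      using mvt[of b 1] ab b1 by auto
    have "?d \<xi> = l" using \<xi> ab b1 psi_S_has_derivative[of \<xi> \<delta>] DERIV_unique by auto
    moreover have "?d \<eta> = l'" using \<eta> \<xi> ab psi_S_has_derivative[of \<eta> \<delta>] DERIV_unique by auto
    moreover have "l = 0" using \<xi> by auto
    moreover have "0 < l'" using \<eta>(4) psi_S_one[OF \<delta>] b1 by (simp add: zero_less_mult_iff)
    moreover have "ln (1 - \<eta>) < ln (1 - \<xi>)" "ln \<xi> < ln \<eta>" using \<xi> \<eta> ab by auto
    then have "\<delta> * (ln (1 - \<eta>) - ln \<eta>) < \<delta> * (ln (1 - \<xi>) - ln \<xi>)"
      using \<delta> by (intro mult_strict_left_mono) auto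
    ultimately show False by linarith
  qed
  then show ?thesis using a b by (meson linorder_less_linear)
qed

text \<open>The intermediate value theorem gives a zero between 0 and \<open>r\<close>, and
  uniqueness identifies it with \<open>rho_S \<delta>\<close>.\<close>

lemma rho_S_le:
  assumes \<delta>: "1/2 \<le> \<delta>" "\<delta> < 1" and r: "0 \<le> r" "r \<le> 1" "0 \<le> psi_S \<delta> r"
  shows "rho_S \<delta> \<le> r"
proof -
  obtain z where z: "0 \<le> z" "z \<le> r" "psi_S \<delta> z = 0"
    using IVT'[of "psi_S \<delta>" 0 0 r] psi_S_zero[OF \<delta>] r
      continuous_on_subset[OF continuous_on_psi_S, of "{0..r}" \<delta>] by auto
  then have "rho_S \<delta> = z"
    unfolding rho_S_def using r psi_S_zero_unique[OF \<delta>] by (intro the_equality) auto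
  then show ?thesis using z by simp
qed

lemma psi_S_neg:
  assumes "1/2 \<le> \<delta>" "\<delta> < 1" "0 \<le> \<rho>" "\<rho> \<le> 1" "\<rho> < rho_S \<delta>"
  shows "psi_S \<delta> \<rho> < 0"
  using rho_S_le[of \<delta> \<rho>] assms by linarith

text \<open>At this value of the second argument the binomial coefficient counting sign patterns is a central one.\<close>

lemma rho_S_le_central:
  assumes \<delta>: "1/2 \<le> \<delta>" "\<delta> < 1"
  shows "rho_S \<delta> \<le> 2 - 1 / \<delta>"
proof (rule rho_S_le[OF \<delta>])
  show "0 \<le> 2 - 1 / \<delta>" "2 - 1 / \<delta> \<le> 1" using \<delta> by (auto simp: field_simps)
  \<comment> \<open>With \<rho> for this argument,
    \<open>1 - \<rho> * \<delta> = 2 * (1 - \<delta>)\<close>. The rate of the pattern count is then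
    \<open>(1 - \<rho> * \<delta>) * ln 2\<close> and cancels; the entropy of
    \<open>\<rho> * \<delta> = 2 * \<delta> - 1\<close> remains.\<close>
  have "psi_S \<delta> (2 - 1 / \<delta>) = shannon_H (2 * \<delta> - 1)"
  proof (cases "\<delta> = 1/2")
    case True
    show ?thesis unfolding True psi_S_def shannon_H_eq by (simp add: ln_div)
  next
    case False
    then have d: "1/2 < \<delta>" using \<delta> by simp
    have eq: "2 - 1 / \<delta> = (2 * \<delta> - 1) / \<delta>" "1 - (2 - 1 / \<delta>) = (1 - \<delta>) / \<delta>"
      "1 - (2 - 1 / \<delta>) * \<delta> = 2 * (1 - \<delta>)" "1 - (2 * \<delta> - 1) = 2 * (1 - \<delta>)"
      using d by (auto simp: field_simps)
    have l: "ln ((2 * \<delta> - 1) / \<delta>) = ln (2 * \<delta> - 1) - ln \<delta>" "ln ((1 - \<delta>) / \<delta>) = ln (1 - \<delta>) - ln \<delta>"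
      "ln (2 * (1 - \<delta>)) = ln 2 + ln (1 - \<delta>)"
      using d \<delta> by (simp add: ln_div, simp add: ln_div, subst ln_mult) auto
    have "\<delta> * shannon_H (2 - 1 / \<delta>) =
      - (2 * \<delta> - 1) * (ln (2 * \<delta> - 1) - ln \<delta>) - (1 - \<delta>) * (ln (1 - \<delta>) - ln \<delta>)"
      unfolding shannon_H_eq eq(2) unfolding eq(1) l using d by (simp add: field_simps)
    then show ?thesis
      unfolding psi_S_def eq(3) unfolding shannon_H_eq eq(4) l by (simp add: algebra_simps)
  qed
  then show "0 \<le> psi_S \<delta> (2 - 1 / \<delta>)" using shannon_H_nonneg[of "2 * \<delta> - 1"] \<delta> by simp
qed

text \<open>This bounds one term of the binomial expansion of \<open>(p + (1 - p)) ^ N = 1\<close>;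
  for \<open>p\<close> near \<open>k / N\<close> the exponential rate is the right one.\<close>

lemma choose_le_inverse_powers:
  assumes p: "0 < p" "p < (1::real)" and k: "k \<le> N"
  shows "real (N choose k) \<le> 1 / (p ^ k * (1 - p) ^ (N - k))"
proof -
  have "real (N choose k) * p ^ k * (1 - p) ^ (N - k) \<le> (\<Sum>l\<le>N. real (N choose l) * p ^ l * (1 - p) ^ (N - l))"
    using p k by (intro member_le_sum) auto
  also have "\<dots> = 1" using binomial_ring[of p "1 - p" N] by simp
  finally show ?thesis using p by (simp add: field_simps)
qed

text \<open>Chernoff's method: for \<open>x \<le> 1\<close> the weights \<open>x ^ l / x ^ m\<close>
  are at least 1 on the range of summation, and the weighted sum completes to a full binomial
  expansion.\<close>

lemma sum_choose_le_powers:
  assumes x: "0 < x" "x \<le> (1::real)" and m: "m \<le> M"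
  shows "real (\<Sum>l\<le>m. M choose l) \<le> (1 + x) ^ M / x ^ m"
proof -
  have "(\<Sum>l\<le>m. real (M choose l)) * x ^ m \<le> (\<Sum>l\<le>m. real (M choose l) * x ^ l)"
    unfolding sum_distrib_right using x by (intro sum_mono mult_left_mono power_decreasing) auto
  also have "\<dots> \<le> (\<Sum>l\<le>M. real (M choose l) * x ^ l)"
    using x m by (intro sum_mono2) auto
  also have "\<dots> = (1 + x) ^ M" using binomial_ring[of x 1 M] by (simp add: add.commute)
  finally show ?thesis using x by (simp add: field_simps)
qed

text \<open>\<open>x\<close> minimises \<open>(1 - p) * ln (1 + x) - (1 - \<delta>) * ln x\<close>,
  the rate given by \<open>sum_choose_le_powers\<close>. The identity is the chain rule for the
  entropy of the masses \<open>\<rho> * \<delta>\<close>, \<open>\<delta> * (1 - \<rho>)\<close> and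
  \<open>1 - \<delta>\<close>, grouped in two ways.\<close>

lemma psi_S_exponent:
  assumes "0 < \<delta>" "\<delta> < 1" "0 < \<rho>" "\<rho> < 1"
  defines "p \<equiv> \<rho> * \<delta>" and "x \<equiv> (1 - \<delta>) / (\<delta> * (1 - \<rho>))"
  shows "- p * ln p - (1 - p) * ln (1 - p) - (1 - \<delta>) * ln x + (1 - p) * ln (1 + x) - (1 - p) * ln 2
    = psi_S \<delta> \<rho>"
proof -
  have p: "0 < p" "p < 1" unfolding p_def using assms mult_strict_mono[of \<rho> 1 \<delta> 1] by auto
  have "1 + x = (1 - p) / (\<delta> * (1 - \<rho>))" unfolding x_def p_def using assms by (simp add: field_simps)
  then have l1: "ln (1 + x) = ln (1 - p) - ln \<delta> - ln (1 - \<rho>)"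
    using assms(1-4) p by (simp add: ln_div ln_mult)
  have l2: "ln x = ln (1 - \<delta>) - ln \<delta> - ln (1 - \<rho>)"
    unfolding x_def using assms(1-4) by (simp add: ln_div ln_mult)
  have l3: "ln p = ln \<rho> + ln \<delta>" unfolding p_def using assms(1-4) by (simp add: ln_mult)
  show ?thesis
    unfolding psi_S_def shannon_H_eq l1 l2 l3 by (simp add: p_def algebra_simps)
qed

lemma union_bound_tendsto_0:
  fixes k N :: "nat \<Rightarrow> nat"
  assumes \<delta>: "1/2 \<le> \<delta>" "\<delta> < 1" and \<rho>: "0 < \<rho>" "\<rho> < 1" "\<rho> < rho_S \<delta>"
    and kN: "\<And>n. n \<ge> 1 \<Longrightarrow> k n < n \<and> n < N n"
    and lim: "(\<lambda>n. real (k n) / real n) \<longlonglongrightarrow> \<rho>" "(\<lambda>n. real n / real (N n)) \<longlonglongrightarrow> \<delta>"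
  shows "(\<lambda>n. real (N n choose k n) * real (\<Sum>l\<le>N n - n. (N n - k n) choose l) / 2 ^ (N n - k n)) \<longlonglongrightarrow> 0"
proof -
  define p where "p = \<rho> * \<delta>"
  define x where "x = (1 - \<delta>) / (\<delta> * (1 - \<rho>))"
  have p: "0 < p" "p < 1" unfolding p_def using \<delta> \<rho> mult_strict_mono[of \<rho> 1 \<delta> 1] by auto
  \<comment> \<open>This inequality is equivalent to \<open>x \<le> 1\<close>.\<close>
  have "\<rho> \<le> 2 - 1 / \<delta>" using rho_S_le_central[OF \<delta>] \<rho> by simp
  then have x: "0 < x" "x \<le> 1" unfolding x_def using \<delta> \<rho> by (auto simp: field_simps)
  \<comment> \<open>\<open>c\<close> is the rate per coordinate off the face, with one term each
    from the choice of the face, the pattern count and the sign changes.\<close>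
  define c where "c = - ln (1 - p) + ln (1 + x) - ln 2"
  define E where "E n = - real (k n) * ln p + real (N n - k n) * c - real (N n - n) * ln x" for n
  have bound: "real (N n choose k n) * real (\<Sum>l\<le>N n - n. (N n - k n) choose l) / 2 ^ (N n - k n) \<le> exp (E n)"
    if n: "n \<ge> 1" for n
  proof -
    have ex: "exp (real j * ln t) = t ^ j" if "0 < t" for j and t :: real
      using that by (simp add: exp_of_nat_mult)
    have "real (N n choose k n) * real (\<Sum>l\<le>N n - n. (N n - k n) choose l) / 2 ^ (N n - k n)
       \<le> 1 / (p ^ k n * (1 - p) ^ (N n - k n)) * ((1 + x) ^ (N n - k n) / x ^ (N n - n)) / 2 ^ (N n - k n)"
      using kN[OF n] p x
      by (intro divide_right_mono mult_mono choose_le_inverse_powers sum_choose_le_powers) (auto intro!: sum_nonneg)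
    also have "\<dots> = exp (E n)"
      unfolding E_def c_def using p x
      by (simp add: right_diff_distrib distrib_left exp_diff exp_add exp_minus ex)
    finally show ?thesis .
  qed
  have N_pos: "eventually (\<lambda>n. 0 < N n \<and> 0 < n \<and> k n < n \<and> n < N n) sequentially"
    using eventually_ge_at_top[of 1] by eventually_elim (use kN in fastforce)
  have kN_lim: "(\<lambda>n. real (k n) / real (N n)) \<longlonglongrightarrow> p"
    unfolding p_def
  proof (rule Lim_transform_eventually[OF tendsto_mult[OF lim]])
    show "\<forall>\<^sub>F n in sequentially. real (k n) / real n * (real n / real (N n)) = real (k n) / real (N n)"
      using N_pos by eventually_elim simp
  qed
  have "(\<lambda>n. - (real (k n) / real (N n)) * ln p + (1 - real (k n) / real (N n)) * c
     - (1 - real n / real (N n)) * ln x) \<longlonglongrightarrow> - p * ln p + (1 - p) * c - (1 - \<delta>) * ln x"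
    by (intro tendsto_intros kN_lim lim)
  moreover have "- p * ln p + (1 - p) * c - (1 - \<delta>) * ln x = psi_S \<delta> \<rho>"
    using psi_S_exponent[of \<delta> \<rho>] \<delta> \<rho> unfolding c_def p_def x_def by (simp add: algebra_simps)
  moreover have "\<forall>\<^sub>F n in sequentially. - (real (k n) / real (N n)) * ln p + (1 - real (k n) / real (N n)) * c
     - (1 - real n / real (N n)) * ln x = E n / real (N n)"
    using N_pos
  proof eventually_elim
    case (elim n)
    then have 1: "1 - real (k n) / real (N n) = real (N n - k n) / real (N n)"
      "1 - real n / real (N n) = real (N n - n) / real (N n)"
      by (simp_all add: of_nat_diff diff_divide_distrib)
    show ?case unfolding 1 E_def by (simp add: add_divide_distrib diff_divide_distrib)
  qed
  ultimately have "(\<lambda>n. E n / real (N n)) \<longlonglongrightarrow> psi_S \<delta> \<rho>"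
    by (simp add: Lim_transform_eventually)
  moreover have "psi_S \<delta> \<rho> < 0" using psi_S_neg \<delta> \<rho> by simp
  \<comment> \<open>As \<open>N n\<close> exceeds \<open>n\<close>, the negative limit of
    \<open>E n / N n\<close> drives \<open>E n\<close> itself to minus infinity.\<close>
  moreover have "filterlim (\<lambda>n. real (N n)) at_top sequentially"
  proof (rule filterlim_at_top_mono[OF filterlim_real_sequentially])
    show "\<forall>\<^sub>F n in sequentially. real n \<le> real (N n)" using N_pos by eventually_elim simp
  qed
  ultimately have "filterlim (\<lambda>n. E n / real (N n) * real (N n)) at_bot sequentially"
    by (intro filterlim_tendsto_neg_mult_at_bot)
  then have "filterlim E at_bot sequentially"
    by (rule filterlim_mono_eventually) (use N_pos in \<open>auto elim: eventually_mono\<close>)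
  then have "(\<lambda>n. exp (E n)) \<longlonglongrightarrow> 0" by (rule filterlim_compose[OF exp_at_bot])
  then show ?thesis
  proof (rule tendsto_sandwich[OF _ _ tendsto_const, rotated 2])
    show "\<forall>\<^sub>F n in sequentially. real (N n choose k n) * real (\<Sum>l\<le>N n - n. (N n - k n) choose l) / 2 ^ (N n - k n) \<le> exp (E n)"
      using eventually_ge_at_top[of 1] by eventually_elim (rule bound)
  qed (auto intro!: always_eventually divide_nonneg_nonneg mult_nonneg_nonneg sum_nonneg)
qed

section \<open>Orthants, matrices and nullspaces\<close>

lemma lookup_scaleR: "Poly_Mapping.lookup (r *\<^sub>R x) i = r *\<^sub>R Poly_Mapping.lookup x i"
proof -
  have "finite {i. r *\<^sub>R Poly_Mapping.lookup x i \<noteq> 0}"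
    by (rule finite_subset[OF _ finite_keys[of x]]) (auto simp: in_keys_iff)
  then show ?thesis by (simp add: scaleR_poly_mapping_def Abs_poly_mapping_inverse)
qed

lemma lookup_sum_single:
  assumes "finite I"
  shows "Poly_Mapping.lookup (\<Sum>i\<in>I. Poly_Mapping.single i (f i)) j = (if j \<in> I then f j else 0)"
  using assms by (simp add: lookup_sum lookup_single when_def)

lemma lookup_mat_vec:
  "Poly_Mapping.lookup (mat_vec m d X x) i = (if i < m then \<Sum>j<d. X (i, j) * Poly_Mapping.lookup x j else 0)"
  by (simp add: mat_vec_def lookup_sum_single)

lemma lookup_mat_col: "Poly_Mapping.lookup (mat_col m X j) i = (if i < m then X (i, j) else 0)"
  by (simp add: mat_col_def lookup_sum_single)

lemma lookup_mat_row: "Poly_Mapping.lookup (mat_row d X i) j = (if j < d then X (i, j) else 0)"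
  by (simp add: mat_row_def lookup_sum_single)

lemma mat_vec_eq_sum_cols: "mat_vec m d X x = (\<Sum>j<d. Poly_Mapping.lookup x j *\<^sub>R mat_col m X j)"
  by (rule poly_mapping_eqI) (auto simp: lookup_mat_vec lookup_sum lookup_scaleR lookup_mat_col mult.commute)

lemma sum_single_in_vecs: "(\<Sum>i<d. Poly_Mapping.single i (f i)) \<in> vecs d"
  by (auto simp: vecs_def in_keys_iff lookup_sum_single split: if_splits)

lemma vecs_eq_sum_single: "x \<in> vecs d \<Longrightarrow> x = (\<Sum>i<d. Poly_Mapping.single i (Poly_Mapping.lookup x i))"
  by (rule poly_mapping_eqI) (auto simp: lookup_sum_single vecs_def in_keys_iff)

lemma mat_vec_image_orthant: "mat_vec n d X ` orthant d = finite_cone {..<d} (mat_col n X)"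
proof (intro subset_antisym subsetI)
  fix y assume "y \<in> finite_cone {..<d} (mat_col n X)"
  then obtain a where a: "\<And>i. i \<in> {..<d} \<Longrightarrow> 0 \<le> a i" "y = (\<Sum>i<d. a i *\<^sub>R mat_col n X i)"
    by (rule finite_coneE) blast
  define x where "x = (\<Sum>i<d. Poly_Mapping.single i (a i))"
  have "x \<in> orthant d" unfolding orthant_def x_def using a sum_single_in_vecs by (auto simp: lookup_sum_single)
  moreover have "y = mat_vec n d X x" unfolding a mat_vec_eq_sum_cols x_def by (simp add: lookup_sum_single)
  ultimately show "y \<in> mat_vec n d X ` orthant d" by blast
qed (auto simp: mat_vec_eq_sum_cols orthant_def intro!: finite_coneI)

lemma orthant_eq_finite_cone: "orthant d = finite_cone {..<d} (\<lambda>i. Poly_Mapping.single i 1)"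
proof -
  have 1: "a *\<^sub>R Poly_Mapping.single i (1::real) = Poly_Mapping.single i a" for a and i :: nat
    by (rule poly_mapping_eqI) (simp add: lookup_scaleR lookup_single when_def)
  show ?thesis
  proof (intro subset_antisym subsetI)
    fix x assume "x \<in> orthant d"
    then have x: "x \<in> vecs d" "\<And>i. i \<in> {..<d} \<Longrightarrow> 0 \<le> Poly_Mapping.lookup x i"
      unfolding orthant_def by auto
    have "(\<Sum>i<d. Poly_Mapping.lookup x i *\<^sub>R Poly_Mapping.single i 1) = x"
      unfolding 1 by (rule vecs_eq_sum_single[OF x(1), symmetric])
    then show "x \<in> finite_cone {..<d} (\<lambda>i. Poly_Mapping.single i 1)"
      using finite_coneI[of "{..<d}" "Poly_Mapping.lookup x" "\<lambda>i. Poly_Mapping.single i (1::real)"] x(2) by simp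
  qed (auto simp: finite_cone_def 1 orthant_def lookup_sum_single sum_single_in_vecs)
qed

lemma independent_single: "independent ((\<lambda>r. Poly_Mapping.single r (1::real)) ` {..<m::nat})"
  "inj_on (\<lambda>r. Poly_Mapping.single r (1::real)) {..<m}"
proof -
  have "z i = 0" if "(\<Sum>i<m. z i *\<^sub>R Poly_Mapping.single i (1::real)) = 0" "i \<in> {..<m}" for z and i :: nat
  proof -
    have "Poly_Mapping.lookup (\<Sum>i<m. z i *\<^sub>R Poly_Mapping.single i (1::real)) i = 0"
      unfolding that(1) by simp
    then show ?thesis using that(2) by (simp add: lookup_sum lookup_scaleR lookup_single when_def if_distrib cong: if_cong)
  qed
  then show "independent ((\<lambda>r. Poly_Mapping.single r (1::real)) ` {..<m::nat})"
    "inj_on (\<lambda>r. Poly_Mapping.single r (1::real)) {..<m}"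
    using inj_on_independent_iff[of "{..<m}" "\<lambda>r. Poly_Mapping.single r (1::real)"] by blast+
qed

text \<open>Unit vectors admit only the trivial relation, so the criterion for images also counts
  the faces of the orthant itself.\<close>

lemma num_faces_orthant:
  assumes "1 \<le> k" shows "num_faces k (orthant d) = d choose k"
proof -
  have "num_faces k (finite_cone {..<d} (\<lambda>i. Poly_Mapping.single i (1::real))) = card {..<d} choose k"
    unfolding num_faces_finite_cone_eq_choose_iff[OF finite_lessThan assms]
    using inj_on_independent_iff[of "{..<d}" "\<lambda>r. Poly_Mapping.single r (1::real)"] independent_single
    by blast
  then show ?thesis by (simp add: orthant_eq_finite_cone)
qed

text \<open>The nullspace meets the tangent cone of the orthant along the face of \<open>J\<close>
  in a nonzero vector. The vector is a bare function, to match \<open>l1_sphere\<close>.\<close>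

definition nonneg_kernel_off :: "nat \<Rightarrow> nat \<Rightarrow> nat set \<Rightarrow> matrix \<Rightarrow> bool" where
  "nonneg_kernel_off n d J X \<longleftrightarrow>
     (\<exists>z. (\<forall>i\<in>{..<d} - J. 0 \<le> z i) \<and> (\<exists>i<d. z i \<noteq> 0) \<and> (\<forall>r<n. (\<Sum>i<d. X (r, i) * z i) = 0))"

lemma sum_mat_col_eq_0_iff:
  "(\<Sum>i<d. z i *\<^sub>R mat_col n X i) = 0 \<longleftrightarrow> (\<forall>r<n. (\<Sum>i<d. X (r, i) * z i) = 0)"
proof -
  have *: "Poly_Mapping.lookup (\<Sum>i<d. z i *\<^sub>R mat_col n X i) r = (if r < n then (\<Sum>i<d. X (r, i) * z i) else 0)" for r
    by (simp add: lookup_sum lookup_scaleR lookup_mat_col mult.commute)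
  have 0: "v = 0 \<longleftrightarrow> (\<forall>r. Poly_Mapping.lookup v r = 0)" for v :: vect
    using poly_mapping_eqI[of v 0] by auto
  show ?thesis unfolding 0 * by auto
qed

lemma num_faces_image_orthant_eq_iff:
  assumes "1 \<le> k"
  shows "num_faces k (mat_vec n d X ` orthant d) = num_faces k (orthant d) \<longleftrightarrow>
    (\<forall>J\<in>{J. J \<subseteq> {..<d} \<and> card J = k}. \<not> nonneg_kernel_off n d J X)"
  using num_faces_finite_cone_eq_choose_iff[OF finite_lessThan assms, of d "mat_col n X"]
  unfolding num_faces_orthant[OF assms] mat_vec_image_orthant sum_mat_col_eq_0_iff nonneg_kernel_off_def
  by (simp add: Ball_def) blast

text \<open>The coefficients are asked to be nonzero, rather than the combination of rows. This can
  only enlarge the event, which is harmless for an upper bound.\<close>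

definition nonneg_rows_off :: "nat \<Rightarrow> nat \<Rightarrow> nat set \<Rightarrow> matrix \<Rightarrow> bool" where
  "nonneg_rows_off m d J Y \<longleftrightarrow>
     (\<exists>y. (\<exists>r<m. y r \<noteq> 0) \<and> (\<forall>i\<in>{..<d} - J. 0 \<le> (\<Sum>r<m. y r * Y (r, i))))"

lemma span_image_lessThan:
  fixes f :: "nat \<Rightarrow> 'a::real_vector"
  assumes "v \<in> span (f ` {..<m})"
  obtains y where "v = (\<Sum>r<m. y r *\<^sub>R f r)"
proof -
  let ?g = "\<lambda>y. \<Sum>r<m. y r *\<^sub>R f r"
  let ?L = "range ?g"
  have "v \<in> ?L"
  proof (rule set_mp[OF span_minimal assms])
    show "f ` {..<m} \<subseteq> ?L"
    proof (rule image_subsetI)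
      fix j assume "j \<in> {..<m}"
      then have "f j = (\<Sum>r<m. (if r = j then 1 else 0) *\<^sub>R f r)"
        by (simp add: if_distrib[of "\<lambda>t. t *\<^sub>R _"] cong: if_cong)
      then show "f j \<in> ?L" by (rule range_eqI[where f = ?g])
    qed
    show "subspace ?L"
    proof (rule subspaceI)
      have "0 = (\<Sum>r<m. 0 *\<^sub>R f r)" by simp
      then show "0 \<in> ?L" by (rule range_eqI[where f = ?g])
    next
      fix a b assume "a \<in> ?L" "b \<in> ?L"
      then obtain y y' where "a = (\<Sum>r<m. y r *\<^sub>R f r)" "b = (\<Sum>r<m. y' r *\<^sub>R f r)" by blast
      then have "a + b = (\<Sum>r<m. (y r + y' r) *\<^sub>R f r)" by (simp add: scaleR_add_left sum.distrib)
      then show "a + b \<in> ?L" by (rule range_eqI[where f = ?g])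
    next
      fix c a assume "a \<in> ?L"
      then obtain y where "a = (\<Sum>r<m. y r *\<^sub>R f r)" by blast
      then have "c *\<^sub>R a = (\<Sum>r<m. (c * y r) *\<^sub>R f r)" by (simp add: scaleR_sum_right)
      then show "c *\<^sub>R a \<in> ?L" by (rule range_eqI[where f = ?g])
    qed
  qed
  then show ?thesis using that by blast
qed

text \<open>A nonzero kernel vector is a row combination whose coefficients cannot all vanish. This
  transfers the failure event from \<open>A\<close> to \<open>B\<close>.\<close>

lemma nonneg_kernel_off_imp_rows:
  assumes eq: "nullspace n d X = row_space m d Y" and X: "nonneg_kernel_off n d J X"
  shows "nonneg_rows_off m d J Y"
proof -
  obtain z j where z: "\<forall>i\<in>{..<d} - J. 0 \<le> z i" "j < d" "z j \<noteq> 0" "\<forall>r<n. (\<Sum>i<d. X (r, i) * z i) = 0"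
    using X unfolding nonneg_kernel_off_def by blast
  define v where "v = (\<Sum>i<d. Poly_Mapping.single i (z i))"
  have lv: "Poly_Mapping.lookup v i = z i" if "i < d" for i
    unfolding v_def using that by (simp add: lookup_sum_single)
  have "mat_vec n d X v = 0"
    by (rule poly_mapping_eqI) (simp add: lookup_mat_vec lv z)
  then have "v \<in> row_space m d Y"
    unfolding eq[symmetric] nullspace_def v_def using sum_single_in_vecs by blast
  then obtain y where y: "v = (\<Sum>r<m. y r *\<^sub>R mat_row d Y r)"
    unfolding row_space_def by (rule span_image_lessThan)
  have zy: "z i = (\<Sum>r<m. y r * Y (r, i))" if "i < d" for i
    using lv[OF that] that unfolding y by (simp add: lookup_sum lookup_scaleR lookup_mat_row)
  have "\<exists>r<m. y r \<noteq> 0"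
  proof (rule ccontr)
    assume "\<not> (\<exists>r<m. y r \<noteq> 0)"
    then show False using zy[OF z(2)] z(3) by simp
  qed
  moreover have "\<forall>i\<in>{..<d} - J. 0 \<le> (\<Sum>r<m. y r * Y (r, i))" using z(1) zy by simp
  ultimately show ?thesis unfolding nonneg_rows_off_def by blast
qed

text \<open>The independence of every \<open>m\<close> columns lets a weak solution of the sign conditions be
  perturbed to a strict one: the columns orthogonal to it are fewer than \<open>m\<close>, so a small
  correction can be prescribed freely on them.\<close>

lemma strict_perturbation:
  fixes y s :: "nat \<Rightarrow> real"
  assumes generic: "\<And>J. J \<subseteq> I \<Longrightarrow> card J = m \<Longrightarrow> inj_on (mat_col m Y) J \<and> independent (mat_col m Y ` J)"
    and I: "finite I" "m \<le> card I" and s: "\<And>i. i \<in> I \<Longrightarrow> s i \<in> {-1, 1}"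
    and y: "\<exists>r<m. y r \<noteq> 0" "\<And>i. i \<in> I \<Longrightarrow> 0 \<le> s i * (\<Sum>r<m. y r * Y (r, i))"
  obtains w where "\<And>i. i \<in> I \<Longrightarrow> 0 < s i * (\<Sum>r<m. w r * Y (r, i))"
proof -
  let ?e = "\<lambda>r. Poly_Mapping.single r (1::real)"
  define E where "E = ?e ` {..<m}"
  have E: "finite E" "independent E" "card E = m"
    unfolding E_def using independent_single[of m] by (auto simp: card_image)
  have col: "mat_col m Y i = (\<Sum>r<m. Y (r, i) *\<^sub>R ?e r)" for i
    by (rule poly_mapping_eqI) (simp add: lookup_mat_col lookup_sum lookup_scaleR lookup_single when_def if_distrib cong: if_cong)
  have col_span: "mat_col m Y i \<in> span E" for i
    unfolding col E_def by (rule span_sum, rule span_scale, rule span_base) simp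
  have functional: "f (mat_col m Y i) = (\<Sum>r<m. f (?e r) * Y (r, i))" if "linear f" for f :: "vect \<Rightarrow> real" and i
    unfolding col using that by (simp add: linear_sum[OF that] linear_scale[OF that] mult.commute)
  define a where "a y i = (\<Sum>r<m. y r * Y (r, i))" for y i
  define Z where "Z = {i \<in> I. a y i = 0}"
  \<comment> \<open>A functional with coefficients \<open>y\<close> vanishing on \<open>m\<close>
    independent columns would vanish on all of \<open>span E\<close>, although some
    \<open>y r\<close> is nonzero.\<close>
  have "card Z < m"
  proof (rule ccontr)
    assume "\<not> card Z < m"
    then obtain J where J: "J \<subseteq> Z" "card J = m"
      by (meson linorder_not_less obtain_subset_with_card_n)
    then have JI: "J \<subseteq> I" unfolding Z_def by blast
    define f where "f v = (\<Sum>r<m. y r * Poly_Mapping.lookup v r)" for v :: vect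
    have f: "linear f"
      by (rule linearI) (simp_all add: f_def lookup_add lookup_scaleR algebra_simps sum.distrib sum_distrib_left)
    have fe: "f (?e r) = y r" if "r < m" for r
      unfolding f_def using that by (simp add: lookup_single when_def if_distrib cong: if_cong)
    have "span (mat_col m Y ` J) = span E"
      using generic[OF JI J(2)] col_span E J(2)
      by (intro independent_same_card_span) (auto simp: card_image)
    moreover have "f v = 0" if "v \<in> span (mat_col m Y ` J)" for v
    proof (rule linear_eq_0_on_span[OF f _ that])
      fix x assume "x \<in> mat_col m Y ` J"
      then obtain i where "i \<in> Z" "x = mat_col m Y i" using J by blast
      then show "f x = 0" using functional[OF f, of i] fe unfolding Z_def a_def by simp
    qed
    ultimately have "f (?e r) = 0" if "r < m" for r
      using that span_base[of "?e r" E] unfolding E_def by blast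
    then show False using y(1) fe by auto
  qed
  \<comment> \<open>Genericity speaks of exactly \<open>m\<close> columns, so \<open>Z\<close> is
    enlarged to an \<open>m\<close>-subset of \<open>I\<close>, which exists by
    \<open>m \<le> card I\<close>.\<close>
  then obtain J where J: "Z \<subseteq> J" "J \<subseteq> I" "card J = m"
    using exists_subset_between[of Z m I] I unfolding Z_def by auto
  then have inj: "inj_on (mat_col m Y) Z" and indep: "independent (mat_col m Y ` Z)"
    using generic[OF J(2,3)] by (meson inj_on_subset, meson independent_mono image_mono)
  \<comment> \<open>The correction takes the value \<open>s i\<close> at the columns of
    \<open>Z\<close>; multiplied by \<open>s i\<close>, its multiple by \<open>\<epsilon>\<close>
    contributes exactly \<open>\<epsilon>\<close>.\<close>
  obtain g where g: "linear g" "\<And>v. v \<in> mat_col m Y ` Z \<Longrightarrow> g v = s (the_inv_into Z (mat_col m Y) v)"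
    using linear_independent_extend[OF indep, of "\<lambda>v. s (the_inv_into Z (mat_col m Y) v)"] by blast
  define u where "u r = g (?e r)" for r
  have u: "a u i = s i" if "i \<in> Z" for i
    using g(2)[of "mat_col m Y i"] functional[OF g(1), of i] that the_inv_into_f_f[OF inj that]
    unfolding a_def u_def by simp
  have lin: "a (\<lambda>r. y r + \<epsilon> * u r) i = a y i + \<epsilon> * a u i" for \<epsilon> i
    unfolding a_def by (simp add: algebra_simps sum.distrib sum_distrib_left)
  \<comment> \<open>On \<open>Z\<close> every positive \<open>\<epsilon>\<close> works; elsewhere
    the inequality is already strict and persists for small \<open>\<epsilon>\<close>.\<close>
  have "\<forall>\<^sub>F \<epsilon> in at_right 0. 0 < s i * a (\<lambda>r. y r + \<epsilon> * u r) i" if i: "i \<in> I" for i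
  proof (cases "i \<in> Z")
    case True
    have "\<forall>\<^sub>F \<epsilon> in at_right (0::real). 0 < \<epsilon>" by (rule eventually_at_right_less)
    then show ?thesis
    proof eventually_elim
      case (elim \<epsilon>)
      have "s i * (a y i + \<epsilon> * s i) = \<epsilon>" using s[OF i] True unfolding Z_def by auto
      then show ?case unfolding lin u[OF True] using elim by simp
    qed
  next
    case False
    then have "0 < s i * a y i"
      using y(2)[OF i] s[OF i] i unfolding Z_def a_def[symmetric] by (auto simp: less_le)
    moreover have "((\<lambda>\<epsilon>. s i * (a y i + \<epsilon> * a u i)) \<longlongrightarrow> s i * (a y i + 0 * a u i)) (at_right 0)"
      by (intro tendsto_intros)
    ultimately show ?thesis unfolding lin using order_tendstoD(1)[of _ "s i * a y i" _ 0] by simp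
  qed
  then have "\<forall>\<^sub>F \<epsilon> in at_right 0. \<forall>i\<in>I. 0 < s i * a (\<lambda>r. y r + \<epsilon> * u r) i"
    using I(1) by (intro eventually_ball_finite) auto
  then obtain \<epsilon> where "\<forall>i\<in>I. 0 < s i * a (\<lambda>r. y r + \<epsilon> * u r) i"
    using eventually_happens'[OF trivial_limit_at_right_real] by blast
  then show ?thesis using that[of "\<lambda>r. y r + \<epsilon> * u r"] unfolding a_def by simp
qed

definition sign_vec :: "nat set \<Rightarrow> nat \<Rightarrow> real" where
  "sign_vec T i = (if i \<in> T then 1 else - 1)"

text \<open>After perturbation, a sign change \<open>T\<close> that satisfies the weak conditions is
  itself a strict pattern of the columns off \<open>J\<close>, viewed as functionals on an
  \<open>m\<close>-dimensional space.\<close>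

lemma card_sign_changes_le:
  assumes generic: "\<And>J. J \<subseteq> {..<d} \<Longrightarrow> card J = m \<Longrightarrow> inj_on (mat_col m Y) J \<and> independent (mat_col m Y ` J)"
    and m: "m \<le> card ({..<d} - J)"
  shows "card {T \<in> Pow ({..<d} - J). nonneg_rows_off m d J (mat_mult_diag m d Y (sign_vec T))}
    \<le> (\<Sum>l\<le>m. card ({..<d} - J) choose l)"
proof -
  let ?e = "\<lambda>r. Poly_Mapping.single r (1::real)"
  define I where "I = {..<d} - J"
  define \<phi> where "\<phi> i v = (\<Sum>r<m. Poly_Mapping.lookup v r * Y (r, i))" for i and v :: vect
  have lin: "linear (\<phi> i)" for i
    by (rule linearI) (simp_all add: \<phi>_def lookup_add lookup_scaleR algebra_simps sum.distrib sum_distrib_left)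
  have "T \<in> strict_patterns I \<phi> (span (?e ` {..<m}))"
    if T: "T \<subseteq> I" "nonneg_rows_off m d J (mat_mult_diag m d Y (sign_vec T))" for T
  proof -
    obtain y where y: "\<exists>r<m. y r \<noteq> 0"
      "\<And>i. i \<in> I \<Longrightarrow> 0 \<le> (\<Sum>r<m. y r * mat_mult_diag m d Y (sign_vec T) (r, i))"
      using T(2) unfolding nonneg_rows_off_def I_def by blast
    have "(\<Sum>r<m. y r * mat_mult_diag m d Y (sign_vec T) (r, i)) = sign_vec T i * (\<Sum>r<m. y r * Y (r, i))" if "i \<in> I" for i
      using that unfolding sum_distrib_left mat_mult_diag_def I_def by (intro sum.cong) auto
    then have y2: "0 \<le> sign_vec T i * (\<Sum>r<m. y r * Y (r, i))" if "i \<in> I" for i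
      using y(2) that by metis
    obtain w where w: "\<And>i. i \<in> I \<Longrightarrow> 0 < sign_vec T i * (\<Sum>r<m. w r * Y (r, i))"
    proof (rule strict_perturbation[of I m Y "sign_vec T" y])
      show "inj_on (mat_col m Y) J' \<and> independent (mat_col m Y ` J')" if "J' \<subseteq> I" "card J' = m" for J'
        using generic[of J'] that unfolding I_def by blast
    qed (use y y2 m in \<open>auto simp: I_def sign_vec_def\<close>)
    define v where "v = (\<Sum>r<m. Poly_Mapping.single r (w r))"
    have "v = (\<Sum>r<m. w r *\<^sub>R ?e r)"
      by (rule poly_mapping_eqI) (simp add: v_def lookup_sum_single lookup_sum lookup_scaleR lookup_single when_def if_distrib cong: if_cong)
    then have "v \<in> span (?e ` {..<m})"
      by (simp only:) (rule span_sum, rule span_scale, rule span_base, simp)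
    moreover have "0 < sign_vec T i * \<phi> i v" if "i \<in> I" for i
      using w[OF that] by (simp add: \<phi>_def v_def lookup_sum_single)
    then have "\<forall>i\<in>T. 0 < \<phi> i v" "\<forall>i\<in>I - T. \<phi> i v < 0"
      using T(1) unfolding sign_vec_def by (fastforce split: if_splits)+
    ultimately show ?thesis unfolding strict_patterns_def using T(1) by blast
  qed
  then have "{T \<in> Pow I. nonneg_rows_off m d J (mat_mult_diag m d Y (sign_vec T))}
     \<subseteq> strict_patterns I \<phi> (span (?e ` {..<m}))" by blast
  moreover have "finite (strict_patterns I \<phi> (span (?e ` {..<m})))"
    unfolding strict_patterns_def I_def by simp
  ultimately have "card {T \<in> Pow I. nonneg_rows_off m d J (mat_mult_diag m d Y (sign_vec T))}
     \<le> card (strict_patterns I \<phi> (span (?e ` {..<m})))" by (rule card_mono[rotated])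
  also have "\<dots> \<le> (\<Sum>l\<le>m. card I choose l)"
    using card_image_le[of "{..<m}" ?e] lin by (intro card_strict_patterns_le) (auto simp: I_def)
  finally show ?thesis unfolding I_def .
qed

section \<open>Probability of losing a face\<close>

lemma sets_nonneg_kernel_off:
  "{X \<in> space (matrix_space n d). nonneg_kernel_off n d J X} \<in> sets (matrix_space n d)"
proof -
  \<comment> \<open>The equations are merged into one nonnegative continuous function whose zeros
    are their common solutions.\<close>
  let ?g = "\<lambda>X z. \<Sum>r<n. \<bar>\<Sum>i<d. X (r, i) * z i\<bar>"
  have "{X \<in> space (matrix_space n d). \<exists>z\<in>l1_sphere d ({..<d} - J). ?g X z = 0} \<in> sets (matrix_space n d)"
  proof (rule sets_ex_zero_compact[OF compact_l1_sphere])
    fix z :: "nat \<Rightarrow> real"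
    have "(\<lambda>X. X (r, i)) \<in> borel_measurable (matrix_space n d)" if "r < n" "i < d" for r i
      using that by (intro measurable_component_singleton) auto
    then show "(\<lambda>X. ?g X z) \<in> borel_measurable (matrix_space n d)"
      by (intro borel_measurable_sum borel_measurable_abs borel_measurable_times) auto
  next
    fix X :: matrix
    show "continuous_on (l1_sphere d ({..<d} - J)) (?g X)"
      by (rule continuous_on_subset[OF _ subset_UNIV]) (intro continuous_intros, simp)
  qed (auto intro: sum_nonneg)
  moreover have "(\<exists>z\<in>l1_sphere d ({..<d} - J). ?g X z = 0) \<longleftrightarrow> nonneg_kernel_off n d J X" for X
  proof -
    have "?g X z = 0 \<longleftrightarrow> (\<forall>r<n. (\<Sum>i<d. X (r, i) * z i) = 0)" for z
      by (auto simp: sum_nonneg_eq_0_iff)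
    moreover have "(\<exists>z\<in>l1_sphere d ({..<d} - J). \<forall>r<n. (\<Sum>i<d. X (r, i) * z i) = 0)
      \<longleftrightarrow> nonneg_kernel_off n d J X"
      unfolding nonneg_kernel_off_def
    proof (rule ex_l1_sphere_iff)
      fix z :: "nat \<Rightarrow> real" and t :: real
      assume "\<forall>r<n. (\<Sum>i<d. X (r, i) * z i) = 0"
      moreover have "(\<Sum>i<d. X (r, i) * (t * z i)) = t * (\<Sum>i<d. X (r, i) * z i)" for r
        by (simp add: sum_distrib_left algebra_simps)
      ultimately show "\<forall>r<n. (\<Sum>i<d. X (r, i) * (t * z i)) = 0" by simp
    qed auto
    ultimately show ?thesis by simp
  qed
  ultimately show ?thesis by simp
qed

lemma sets_nonneg_rows_off:
  "{Y \<in> space (matrix_space m d). nonneg_rows_off m d J Y} \<in> sets (matrix_space m d)"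
proof -
  \<comment> \<open>Each inequality becomes a continuous penalty that vanishes exactly when it
    holds.\<close>
  let ?g = "\<lambda>Y y. \<Sum>i\<in>{..<d} - J. max 0 (- (\<Sum>r<m. y r * Y (r, i)))"
  have "{Y \<in> space (matrix_space m d). \<exists>y\<in>l1_sphere m {}. ?g Y y = 0} \<in> sets (matrix_space m d)"
  proof (rule sets_ex_zero_compact[OF compact_l1_sphere])
    fix y :: "nat \<Rightarrow> real"
    have "(\<lambda>Y. Y (r, i)) \<in> borel_measurable (matrix_space m d)" if "r < m" "i < d" for r i
      using that by (intro measurable_component_singleton) auto
    then show "(\<lambda>Y. ?g Y y) \<in> borel_measurable (matrix_space m d)"
      by (intro borel_measurable_sum borel_measurable_max borel_measurable_uminus borel_measurable_times) auto
  next
    fix Y :: matrix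
    show "continuous_on (l1_sphere m {}) (?g Y)"
      by (rule continuous_on_subset[OF _ subset_UNIV]) (intro continuous_intros, simp)
  qed (auto intro: sum_nonneg)
  moreover have "(\<exists>y\<in>l1_sphere m {}. ?g Y y = 0) \<longleftrightarrow> nonneg_rows_off m d J Y" for Y
  proof -
    have "?g Y y = 0 \<longleftrightarrow> (\<forall>i\<in>{..<d} - J. 0 \<le> (\<Sum>r<m. y r * Y (r, i)))" for y
    proof -
      have "max 0 (- t) = 0 \<longleftrightarrow> 0 \<le> t" for t :: real by auto
      then show ?thesis by (simp add: sum_nonneg_eq_0_iff)
    qed
    moreover have "(\<exists>y\<in>l1_sphere m {}. \<forall>i\<in>{..<d} - J. 0 \<le> (\<Sum>r<m. y r * Y (r, i)))
      \<longleftrightarrow> (\<exists>y. (\<forall>i\<in>{}. 0 \<le> y i) \<and> (\<exists>r<m. y r \<noteq> 0) \<and> (\<forall>i\<in>{..<d} - J. 0 \<le> (\<Sum>r<m. y r * Y (r, i))))"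
    proof (rule ex_l1_sphere_iff)
      fix y :: "nat \<Rightarrow> real" and t :: real
      assume "0 < t" "\<forall>i\<in>{..<d} - J. 0 \<le> (\<Sum>r<m. y r * Y (r, i))"
      moreover have "(\<Sum>r<m. t * y r * Y (r, i)) = t * (\<Sum>r<m. y r * Y (r, i))" for i
        by (simp add: sum_distrib_left algebra_simps)
      ultimately show "\<forall>i\<in>{..<d} - J. 0 \<le> (\<Sum>r<m. t * y r * Y (r, i))" by simp
    qed auto
    ultimately show ?thesis unfolding nonneg_rows_off_def by simp
  qed
  ultimately show ?thesis by simp
qed

lemma measurable_mat_mult_diag:
  assumes "random_matrix M m d B"
  shows "(\<lambda>\<omega>. mat_mult_diag m d (B \<omega>) s) \<in> M \<rightarrow>\<^sub>M matrix_space m d"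
  unfolding mat_mult_diag_def
proof (rule measurable_restrict)
  fix ij assume ij: "ij \<in> {..<m} \<times> {..<d}"
  have "(\<lambda>\<omega>. B \<omega> ij) \<in> borel_measurable M"
    using measurable_compose[OF assms[unfolded random_matrix_def] measurable_component_singleton[OF ij]] .
  then show "(\<lambda>\<omega>. case ij of (i, j) \<Rightarrow> B \<omega> (i, j) * s j) \<in> borel_measurable M"
    by (cases ij) simp
qed

text \<open>All \<open>2\<^sup>|\<^sup>I\<^sup>|\<close> sign changes of the columns off \<open>J\<close> give the same probability, and
  almost surely only few of them succeed simultaneously.\<close>

lemma (in prob_space) prob_nonneg_rows_off_le:
  assumes B: "random_matrix M m d B" and sym: "orthant_symmetric M m d B"
    and gen: "generic_columns M m d B" and m: "m \<le> card ({..<d} - J)"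
  shows "prob {\<omega> \<in> space M. nonneg_rows_off m d J (B \<omega>)}
    \<le> real (\<Sum>l\<le>m. card ({..<d} - J) choose l) / 2 ^ card ({..<d} - J)"
proof -
  define I where "I = {..<d} - J"
  define \<Omega> where "\<Omega> = {Y \<in> space (matrix_space m d). nonneg_rows_off m d J Y}"
  define E where "E T = {\<omega> \<in> space M. mat_mult_diag m d (B \<omega>) (sign_vec T) \<in> \<Omega>}" for T
  define q where "q = prob {\<omega> \<in> space M. nonneg_rows_off m d J (B \<omega>)}"
  define c where "c = real (\<Sum>l\<le>m. card I choose l)"
  have finI: "finite I" unfolding I_def by simp
  have \<Omega>: "\<Omega> \<in> sets (matrix_space m d)" unfolding \<Omega>_def by (rule sets_nonneg_rows_off)
  have E: "E T \<in> events" for T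
    unfolding E_def using measurable_sets[OF measurable_mat_mult_diag[OF B] \<Omega>] by (simp add: vimage_def Int_def conj_commute)
  have "prob (E T) = q" for T
  proof -
    have "sign_vec T \<in> {..<d} \<rightarrow> {-1, 1}" by (simp add: sign_vec_def)
    then have "prob (E T) = prob {\<omega> \<in> space M. B \<omega> \<in> \<Omega>}"
      using sym \<Omega> unfolding orthant_symmetric_def E_def by blast
    also have "{\<omega> \<in> space M. B \<omega> \<in> \<Omega>} = {\<omega> \<in> space M. nonneg_rows_off m d J (B \<omega>)}"
      using measurable_space[OF B[unfolded random_matrix_def]] unfolding \<Omega>_def by blast
    finally show ?thesis unfolding q_def .
  qed
  \<comment> \<open>Subsets of \<open>I\<close> suffice, since the columns in \<open>J\<close> do
    not enter the condition.\<close>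
  then have "2 ^ card I * q = (\<Sum>T\<in>Pow I. prob (E T))"
    by (simp add: card_Pow[OF finI])
  \<comment> \<open>The sum of the probabilities is the expected number of sign changes for which
    the event occurs.\<close>
  also have "\<dots> = (\<integral>\<omega>. (\<Sum>T\<in>Pow I. indicator (E T) \<omega>) \<partial>M)"
    using E by (subst Bochner_Integration.integral_sum) (auto simp: emeasure_eq_measure)
  also have "\<dots> \<le> (\<integral>\<omega>. c \<partial>M)"
  proof (rule integral_mono_AE)
    show "integrable M (\<lambda>\<omega>. \<Sum>T\<in>Pow I. indicator (E T) \<omega> :: real)"
      using E by (intro Bochner_Integration.integrable_sum) (auto simp: emeasure_eq_measure)
    \<comment> \<open>There are finitely many column sets, so almost surely all of them are
      independent at once.\<close>
    have "AE \<omega> in M. \<forall>J\<in>{J. J \<subseteq> {..<d} \<and> card J = m}.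
        inj_on (mat_col m (B \<omega>)) J \<and> independent (mat_col m (B \<omega>) ` J)"
      using gen unfolding generic_columns_def by (intro AE_finite_allI) auto
    then show "AE \<omega> in M. (\<Sum>T\<in>Pow I. indicator (E T) \<omega>) \<le> c"
    proof (rule AE_mp, intro AE_I2 impI)
      fix \<omega> assume \<omega>: "\<omega> \<in> space M" and g: "\<forall>J\<in>{J. J \<subseteq> {..<d} \<and> card J = m}.
        inj_on (mat_col m (B \<omega>)) J \<and> independent (mat_col m (B \<omega>) ` J)"
      have "(\<Sum>T\<in>Pow I. indicator (E T) \<omega>) = real (card {T \<in> Pow I. \<omega> \<in> E T})"
        using finI by (simp add: indicator_def sum.If_cases Int_def)
      also have "\<dots> \<le> real (card {T \<in> Pow I. nonneg_rows_off m d J (mat_mult_diag m d (B \<omega>) (sign_vec T))})"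
        using finI by (intro of_nat_mono card_mono) (auto simp: E_def \<Omega>_def)
      also have "\<dots> \<le> c"
        unfolding c_def I_def using g m by (intro of_nat_mono card_sign_changes_le) auto
      finally show "(\<Sum>T\<in>Pow I. indicator (E T) \<omega>) \<le> c" .
    qed
  qed simp
  also have "\<dots> = c" by (simp add: prob_space)
  finally have "q \<le> c / 2 ^ card I" by (simp add: field_simps)
  then show ?thesis unfolding q_def c_def I_def .
qed

lemma (in prob_space) prob_num_faces_eq_ge:
  assumes k: "1 \<le> k" "k < n" "n < d"
    and A: "random_matrix M n d A" "orthant_symmetric_generic_nullspace M n d A"
  shows "1 - real (d choose k) * real (\<Sum>l\<le>d - n. (d - k) choose l) / 2 ^ (d - k)
    \<le> prob {\<omega> \<in> space M. num_faces k (mat_vec n d (A \<omega>) ` orthant d) = num_faces k (orthant d)}"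
proof -
  obtain B where B: "random_matrix M (d - n) d B" "orthant_symmetric M (d - n) d B"
    "generic_columns M (d - n) d B" and eq: "AE \<omega> in M. nullspace n d (A \<omega>) = row_space (d - n) d (B \<omega>)"
    using A(2) unfolding orthant_symmetric_generic_nullspace_def by blast
  define Js where "Js = {J. J \<subseteq> {..<d} \<and> card J = k}"
  define bad where "bad J = {\<omega> \<in> space M. nonneg_kernel_off n d J (A \<omega>)}" for J
  define u where "u = real (\<Sum>l\<le>d - n. (d - k) choose l) / 2 ^ (d - k)"
  have Js: "finite Js" "card Js = d choose k"
    unfolding Js_def using n_subsets[of "{..<d}" k] by simp_all
  have vimage: "{\<omega> \<in> space M. P (X \<omega>)} \<in> events"
    if "random_matrix M i j X" "{Y \<in> space (matrix_space i j). P Y} \<in> sets (matrix_space i j)" for i j X P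
    using that unfolding random_matrix_def by (rule measurable_sets_Collect)
  have bad: "bad J \<in> events" for J
    unfolding bad_def by (rule vimage[OF A(1) sets_nonneg_kernel_off])
  have "prob (bad J) \<le> u" if J: "J \<in> Js" for J
  proof -
    have card: "card ({..<d} - J) = d - k"
      using J unfolding Js_def by (auto simp: card_Diff_subset finite_subset[OF _ finite_lessThan])
    \<comment> \<open>The inclusion of events holds only outside a null set, because the nullspace
      identity is almost sure.\<close>
    have "prob (bad J) \<le> prob {\<omega> \<in> space M. nonneg_rows_off (d - n) d J (B \<omega>)}"
    proof (rule finite_measure_mono_AE)
      show "AE \<omega> in M. \<omega> \<in> bad J \<longrightarrow> \<omega> \<in> {\<omega> \<in> space M. nonneg_rows_off (d - n) d J (B \<omega>)}"
        using eq by eventually_elim (auto simp: bad_def dest: nonneg_kernel_off_imp_rows)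
    qed (rule vimage[OF B(1) sets_nonneg_rows_off])
    \<comment> \<open>\<open>k < n\<close> gives \<open>d - n \<le> d - k\<close>, so enough columns
      remain off \<open>J\<close>.\<close>
    also have "\<dots> \<le> u"
      using prob_nonneg_rows_off_le[OF B, of J] k unfolding card u_def by simp
    finally show ?thesis .
  qed
  then have "(\<Sum>J\<in>Js. prob (bad J)) \<le> real (d choose k) * u"
    using sum_bounded_above[of Js "\<lambda>J. prob (bad J)" u] Js(2) by simp
  then have "prob (\<Union>J\<in>Js. bad J) \<le> real (d choose k) * u"
    using finite_measure_subadditive_finite[OF Js(1), of bad] bad by fastforce
  moreover have "{\<omega> \<in> space M. num_faces k (mat_vec n d (A \<omega>) ` orthant d) = num_faces k (orthant d)}
    = space M - (\<Union>J\<in>Js. bad J)"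
    unfolding num_faces_image_orthant_eq_iff[OF k(1)] bad_def Js_def by auto
  moreover have "(\<Union>J\<in>Js. bad J) \<in> events" using bad Js(1) by blast
  ultimately show ?thesis using prob_compl[of "\<Union>J\<in>Js. bad J"] by (simp add: u_def)
qed

theorem theorem1p7:
  fixes \<delta> \<rho> :: real
    and k N :: "nat \<Rightarrow> nat"
    and M :: "nat \<Rightarrow> 'w measure"
    and A :: "nat \<Rightarrow> 'w \<Rightarrow> matrix"
  assumes "1/2 \<le> \<delta>" and "\<delta> < 1"
    and "0 < \<rho>" and "\<rho> < 1" and "\<rho> < rho_S \<delta>"
    and "\<And>n. n \<ge> 1 \<Longrightarrow> k n < n \<and> n < N n"
    and "(\<lambda>n. real (k n) / real n) \<longlonglongrightarrow> \<rho>"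
    and "(\<lambda>n. real n / real (N n)) \<longlonglongrightarrow> \<delta>"
    and "\<And>n. n \<ge> 1 \<Longrightarrow> prob_space (M n)"
    and "\<And>n. n \<ge> 1 \<Longrightarrow> random_matrix (M n) n (N n) (A n)"
    and "\<And>n. n \<ge> 1 \<Longrightarrow> orthant_symmetric_generic_nullspace (M n) n (N n) (A n)"
  shows "(\<lambda>n. \<P>(\<omega> in M n. num_faces (k n) (mat_vec n (N n) (A n \<omega>) ` orthant (N n))
                           = num_faces (k n) (orthant (N n)))) \<longlonglongrightarrow> 1"
proof -
  let ?U = "\<lambda>n. real (N n choose k n) * real (\<Sum>l\<le>N n - n. (N n - k n) choose l) / 2 ^ (N n - k n)"
  \<comment> \<open>As \<rho> is positive, \<open>k n\<close> is eventually at least 1, which the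
    face criterion requires.\<close>
  have "\<forall>\<^sub>F n in sequentially. 0 < real (k n) / real n"
    using order_tendstoD(1)[OF assms(7,3)] .
  then have k_pos: "\<forall>\<^sub>F n in sequentially. 1 \<le> k n \<and> 1 \<le> n"
    by eventually_elim (auto simp: zero_less_divide_iff)
  have "(\<lambda>n. 1 - ?U n) \<longlonglongrightarrow> 1 - 0"
    by (intro tendsto_diff tendsto_const union_bound_tendsto_0[OF assms(1-5)] assms(6-8))
  then have "(\<lambda>n. 1 - ?U n) \<longlonglongrightarrow> 1" by simp
  then show ?thesis
  proof (rule tendsto_sandwich[OF _ _ _ tendsto_const, rotated 2])
    show "\<forall>\<^sub>F n in sequentially. 1 - ?U n \<le>
      \<P>(\<omega> in M n. num_faces (k n) (mat_vec n (N n) (A n \<omega>) ` orthant (N n)) = num_faces (k n) (orthant (N n)))"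
      using k_pos
    proof eventually_elim
      case (elim n)
      then show ?case
        using prob_space.prob_num_faces_eq_ge[OF assms(9)] assms(6,10,11) by blast
    qed
    show "\<forall>\<^sub>F n in sequentially.
      \<P>(\<omega> in M n. num_faces (k n) (mat_vec n (N n) (A n \<omega>) ` orthant (N n)) = num_faces (k n) (orthant (N n))) \<le> 1"
      using k_pos by eventually_elim (use assms(9) prob_space.prob_le_1 in blast)
  qed
qed

end
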